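(* Let $w(x_1)=x_1^2$ and let $C_w$ be the class of groups of bounded $2$-torsion. The first Grigorchuk group $G_{\mathrm{Grig}}$ satisfies the iterated identity $w$ (of solvability type as well as of Engel type; i.e. for every $g\in G_{\mathrm{Grig}}$ there is $N\ge 1$ with $g^{2^N}=e$), but $G_{\mathrm{Grig}}$ does not belong to $E(C_w)$.
   Context: A group $H$ has bounded $2$-torsion if there is $N\ge 1$ such that $h^{2^N}=e$ for all $h\in H$. Given a class of groups $C$, $E(C)$ denotes the minimal class of groups that contains $C$ and is closed under the four elementary operations: taking subgroups, quotients, direct limits, and group extensions. The first Grigorchuk group is the group of automorphisms of the rooted binary tree $\{0,1\}^*$ generated by $a,b,c,d$, where $a$ swaps the two subtrees at the root and $b,c,d$ fix the first level and are defined recursively by $b=(a,c)$, $c=(a,d)$, $d=(1,b)$ (the pair denoting the action on the two subtrees). For a word in one letter, such as $w(x_1)=x_1^2$, both notions of iterated identity reduce to: for every $g$ there is $N\ge1$ such that the $N$-fold iterate $w(w(\cdots w(g)\cdots))$ is trivial. *)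

theory Defs
  imports "HOL-Algebra.Generated_Groups" "HOL-Library.Sublist"
begin

section \<open>Iterated identities and bounded 2-torsion\<close>

text \<open>A word in one letter is represented by its word map \<open>w\<close>. For such words the Engel-type
  and the solvability-type iterations are the same iteration of \<open>w\<close>.\<close>

definition iterated_identity :: "('a, 'b) monoid_scheme \<Rightarrow> ('a \<Rightarrow> 'a) \<Rightarrow> bool" where
  "iterated_identity G w \<longleftrightarrow> (\<forall>g \<in> carrier G. \<exists>N::nat. N \<ge> 1 \<and> (w ^^ N) g = \<one>\<^bsub>G\<^esub>)"

definition bounded_2_torsion :: "('a, 'b) monoid_scheme \<Rightarrow> bool" where
  "bounded_2_torsion G \<longleftrightarrow>
     group G \<and> (\<exists>N::nat. N \<ge> 1 \<and> (\<forall>h \<in> carrier G. h [^]\<^bsub>G\<^esub> ((2::nat) ^ N) = \<one>\<^bsub>G\<^esub>))"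


section \<open>Direct limits of groups\<close>

locale directed_system =
  fixes I :: "'i set"
    and leq :: "'i \<Rightarrow> 'i \<Rightarrow> bool"
    and D :: "'i \<Rightarrow> ('a, 'b) monoid_scheme"
    and f :: "'i \<Rightarrow> 'i \<Rightarrow> 'a \<Rightarrow> 'a"
  assumes nonempty: "I \<noteq> {}"
    and le_refl: "i \<in> I \<Longrightarrow> leq i i"
    and le_trans: "\<lbrakk>i \<in> I; j \<in> I; k \<in> I; leq i j; leq j k\<rbrakk> \<Longrightarrow> leq i k"
    and directed: "\<lbrakk>i \<in> I; j \<in> I\<rbrakk> \<Longrightarrow> \<exists>k \<in> I. leq i k \<and> leq j k"
    and group_D: "i \<in> I \<Longrightarrow> group (D i)"
    and hom_f: "\<lbrakk>i \<in> I; j \<in> I; leq i j\<rbrakk> \<Longrightarrow> f i j \<in> hom (D i) (D j)"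
    and f_refl: "\<lbrakk>i \<in> I; x \<in> carrier (D i)\<rbrakk> \<Longrightarrow> f i i x = x"
    and f_trans: "\<lbrakk>i \<in> I; j \<in> I; k \<in> I; leq i j; leq j k; x \<in> carrier (D i)\<rbrakk>
                    \<Longrightarrow> f j k (f i j x) = f i k x"

text \<open>The underlying set is the disjoint union of the \<open>D i\<close>, modulo eventual equality.\<close>

definition dirlim_rel ::
  "'i set \<Rightarrow> ('i \<Rightarrow> 'i \<Rightarrow> bool) \<Rightarrow> ('i \<Rightarrow> ('a, 'b) monoid_scheme) \<Rightarrow> ('i \<Rightarrow> 'i \<Rightarrow> 'a \<Rightarrow> 'a)
     \<Rightarrow> (('i \<times> 'a) \<times> ('i \<times> 'a)) set" where
  "dirlim_rel I leq D f =
     {((i, x), (j, y)) | i x j y.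
        i \<in> I \<and> x \<in> carrier (D i) \<and> j \<in> I \<and> y \<in> carrier (D j) \<and>
        (\<exists>k \<in> I. leq i k \<and> leq j k \<and> f i k x = f j k y)}"

text \<open>The unions below run over all choices of representatives; they all give the same class,
  as shown by \<open>one_direct_limit\<close> and \<open>mult_direct_limit\<close>.\<close>

definition direct_limit ::
  "'i set \<Rightarrow> ('i \<Rightarrow> 'i \<Rightarrow> bool) \<Rightarrow> ('i \<Rightarrow> ('a, 'b) monoid_scheme) \<Rightarrow> ('i \<Rightarrow> 'i \<Rightarrow> 'a \<Rightarrow> 'a)
     \<Rightarrow> ('i \<times> 'a) set monoid" where
  "direct_limit I leq D f =
     \<lparr>carrier = (SIGMA i:I. carrier (D i)) // dirlim_rel I leq D f,
      monoid.mult = (\<lambda>A B. \<Union>{dirlim_rel I leq D f `` {(k, f i k x \<otimes>\<^bsub>D k\<^esub> f j k y)} | i x j y k.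
                (i, x) \<in> A \<and> (j, y) \<in> B \<and> k \<in> I \<and> leq i k \<and> leq j k}),
      one = (\<Union>i\<in>I. dirlim_rel I leq D f `` {(i, \<one>\<^bsub>D i\<^esub>)})\<rparr>"

context directed_system
begin

abbreviation R where "R \<equiv> dirlim_rel I leq D f"

abbreviation L where "L \<equiv> direct_limit I leq D f"

lemma f_closed: "\<lbrakk>i \<in> I; j \<in> I; leq i j; x \<in> carrier (D i)\<rbrakk> \<Longrightarrow> f i j x \<in> carrier (D j)"
  using hom_f by (auto simp: hom_def)

lemma f_mult: "\<lbrakk>i \<in> I; j \<in> I; leq i j; x \<in> carrier (D i); y \<in> carrier (D i)\<rbrakk>
    \<Longrightarrow> f i j (x \<otimes>\<^bsub>D i\<^esub> y) = f i j x \<otimes>\<^bsub>D j\<^esub> f i j y"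
  using hom_f by (auto simp: hom_def)

lemma f_one: "\<lbrakk>i \<in> I; j \<in> I; leq i j\<rbrakk> \<Longrightarrow> f i j \<one>\<^bsub>D i\<^esub> = \<one>\<^bsub>D j\<^esub>"
  using hom_one[OF hom_f group_D group_D] by blast

lemma one_closed_D: "i \<in> I \<Longrightarrow> \<one>\<^bsub>D i\<^esub> \<in> carrier (D i)"
  using group_D group.is_monoid monoid.one_closed by blast

lemma mult_closed_D:
  "\<lbrakk>i \<in> I; x \<in> carrier (D i); y \<in> carrier (D i)\<rbrakk> \<Longrightarrow> x \<otimes>\<^bsub>D i\<^esub> y \<in> carrier (D i)"
  using group_D group.is_monoid monoid.m_closed by metis

lemma dirlim_relI:
  "\<lbrakk>i \<in> I; x \<in> carrier (D i); j \<in> I; y \<in> carrier (D j); k \<in> I; leq i k; leq j k; f i k x = f j k y\<rbrakk>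
     \<Longrightarrow> ((i, x), (j, y)) \<in> R"
  by (auto simp: dirlim_rel_def)

lemma dirlim_relE:
  assumes "((i, x), (j, y)) \<in> R"
  obtains k where "i \<in> I" "x \<in> carrier (D i)" "j \<in> I" "y \<in> carrier (D j)" "k \<in> I"
    "leq i k" "leq j k" "f i k x = f j k y"
  using assms by (auto simp: dirlim_rel_def)

lemma f_eq_mono:
  assumes "i \<in> I" "j \<in> I" "k \<in> I" "l \<in> I" "x \<in> carrier (D i)" "y \<in> carrier (D j)"
    "leq i k" "leq j k" "leq k l" "f i k x = f j k y"
  shows "f i l x = f j l y"
  using assms f_trans[of i k l x] f_trans[of j k l y] by simp

lemma equiv_dirlim_rel: "equiv (SIGMA i:I. carrier (D i)) R"
proof (rule equivI)
  show "R \<subseteq> (SIGMA i:I. carrier (D i)) \<times> (SIGMA i:I. carrier (D i))"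
    by (auto simp: dirlim_rel_def)
  show "refl_on (SIGMA i:I. carrier (D i)) R"
    by (auto simp: refl_on_def intro!: dirlim_relI le_refl)
  show "sym R"
  proof (rule symI)
    fix p q assume "(p, q) \<in> R"
    moreover obtain i x j y where [simp]: "p = (i, x)" "q = (j, y)" by (metis surj_pair)
    ultimately obtain k where "i \<in> I" "x \<in> carrier (D i)" "j \<in> I" "y \<in> carrier (D j)" "k \<in> I"
      "leq i k" "leq j k" "f i k x = f j k y" by (auto elim: dirlim_relE)
    then show "(q, p) \<in> R" using dirlim_relI[of j y i x k] by simp
  qed
  show "trans R"
  proof (rule transI)
    fix p q r assume "(p, q) \<in> R" "(q, r) \<in> R"
    moreover obtain i x j y k z where [simp]: "p = (i, x)" "q = (j, y)" "r = (k, z)"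
      by (metis surj_pair)
    ultimately obtain m n where
      m: "i \<in> I" "x \<in> carrier (D i)" "j \<in> I" "y \<in> carrier (D j)" "m \<in> I"
         "leq i m" "leq j m" "f i m x = f j m y" and
      n: "k \<in> I" "z \<in> carrier (D k)" "n \<in> I" "leq j n" "leq k n" "f j n y = f k n z"
      by (auto elim!: dirlim_relE)
    obtain l where l: "l \<in> I" "leq m l" "leq n l" using directed m n by blast
    have "f i l x = f j l y" using f_eq_mono[of i j m l x y] m l by simp
    also have "\<dots> = f k l z" using f_eq_mono[of j k n l y z] m n l by simp
    finally show "(p, r) \<in> R"
      using m n l le_trans[of i m l] le_trans[of k n l] by (auto intro: dirlim_relI[of _ _ _ _ l])
  qed
qed

lemma class_eqI:
  "\<lbrakk>i \<in> I; x \<in> carrier (D i); j \<in> I; y \<in> carrier (D j); k \<in> I; leq i k; leq j k; f i k x = f j k y\<rbrakk>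
     \<Longrightarrow> R `` {(i, x)} = R `` {(j, y)}"
  by (rule equiv_class_eq[OF equiv_dirlim_rel]) (rule dirlim_relI)

lemma class_push:
  assumes "i \<in> I" "x \<in> carrier (D i)" "k \<in> I" "leq i k"
  shows "R `` {(k, f i k x)} = R `` {(i, x)}"
  using assms f_closed[of i k x] le_refl[of k] f_refl[of k "f i k x"]
  by (intro class_eqI[of _ _ _ _ k]) simp_all

lemma carrier_direct_limit: "carrier L = (\<Union>i\<in>I. (\<lambda>x. R `` {(i, x)}) ` carrier (D i))"
  by (auto simp: direct_limit_def quotient_def)

lemma one_direct_limit:
  assumes "i \<in> I"
  shows "\<one>\<^bsub>L\<^esub> = R `` {(i, \<one>\<^bsub>D i\<^esub>)}"
proof -
  have "R `` {(j, \<one>\<^bsub>D j\<^esub>)} = R `` {(i, \<one>\<^bsub>D i\<^esub>)}" if j: "j \<in> I" for j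
  proof -
    obtain k where "k \<in> I" "leq i k" "leq j k" using directed assms j by blast
    then show ?thesis using assms j f_one
      by (intro class_eqI[of _ _ _ _ k]) (auto intro: one_closed_D)
  qed
  then have "(\<Union>j\<in>I. R `` {(j, \<one>\<^bsub>D j\<^esub>)}) = (\<Union>j\<in>I. R `` {(i, \<one>\<^bsub>D i\<^esub>)})"
    by (intro SUP_cong refl)
  also have "\<dots> = R `` {(i, \<one>\<^bsub>D i\<^esub>)}" using assms by blast
  finally show ?thesis by (simp add: direct_limit_def)
qed

lemma mult_direct_limit:
  assumes i: "i \<in> I" "x \<in> carrier (D i)" and j: "j \<in> I" "y \<in> carrier (D j)"
    and k: "k \<in> I" "leq i k" "leq j k"
  shows "R `` {(i, x)} \<otimes>\<^bsub>L\<^esub> R `` {(j, y)} = R `` {(k, f i k x \<otimes>\<^bsub>D k\<^esub> f j k y)}"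
proof -
  have closed: "f i k x \<otimes>\<^bsub>D k\<^esub> f j k y \<in> carrier (D k)"
    if "i \<in> I" "x \<in> carrier (D i)" "j \<in> I" "y \<in> carrier (D j)" "k \<in> I" "leq i k" "leq j k"
    for i x j y k
    using that by (simp add: f_closed mult_closed_D)
  have eq: "R `` {(k', f i' k' x' \<otimes>\<^bsub>D k'\<^esub> f j' k' y')} = R `` {(k, f i k x \<otimes>\<^bsub>D k\<^esub> f j k y)}"
    if a: "((i, x), (i', x')) \<in> R" and b: "((j, y), (j', y')) \<in> R"
      and k': "k' \<in> I" "leq i' k'" "leq j' k'" for i' x' j' y' k'
  proof -
    obtain m where m: "i' \<in> I" "x' \<in> carrier (D i')" "m \<in> I" "leq i m" "leq i' m" "f i m x = f i' m x'"
      using a by (rule dirlim_relE)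
    obtain n where n: "j' \<in> I" "y' \<in> carrier (D j')" "n \<in> I" "leq j n" "leq j' n" "f j n y = f j' n y'"
      using b by (rule dirlim_relE)
    obtain p where p: "p \<in> I" "leq m p" "leq n p" using directed m n by blast
    obtain q where q: "q \<in> I" "leq k q" "leq k' q" using directed k k' by blast
    obtain l where l: "l \<in> I" "leq p l" "leq q l" using directed p q by blast
    have ml: "leq m l" "leq n l" "leq k l" "leq k' l"
      using le_trans l p q m n k k' by blast+
    have "f i l x = f i' l x'" using f_eq_mono[of i i' m l x x'] i m l ml by simp
    moreover have "f j l y = f j' l y'" using f_eq_mono[of j j' n l y y'] j n l ml by simp
    ultimately have "f k' l (f i' k' x' \<otimes>\<^bsub>D k'\<^esub> f j' k' y') = f k l (f i k x \<otimes>\<^bsub>D k\<^esub> f j k y)"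
      using i j k k' m n l ml by (simp add: f_mult f_closed f_trans)
    then show ?thesis
      using i j k k' m n l ml closed by (intro class_eqI[of _ _ _ _ l]) auto
  qed
  have "\<Union>{R `` {(k', f i' k' x' \<otimes>\<^bsub>D k'\<^esub> f j' k' y')} | i' x' j' y' k'.
          (i', x') \<in> R `` {(i, x)} \<and> (j', y') \<in> R `` {(j, y)} \<and> k' \<in> I \<and> leq i' k' \<and> leq j' k'}
        = \<Union>{R `` {(k, f i k x \<otimes>\<^bsub>D k\<^esub> f j k y)}}"
  proof (rule arg_cong[where f = Union], intro equalityI subsetI)
    fix S assume "S \<in> {R `` {(k, f i k x \<otimes>\<^bsub>D k\<^esub> f j k y)}}"
    moreover have "(i, x) \<in> R `` {(i, x)}" "(j, y) \<in> R `` {(j, y)}"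
      using equiv_class_self[OF equiv_dirlim_rel] i j by auto
    ultimately show "S \<in> {R `` {(k', f i' k' x' \<otimes>\<^bsub>D k'\<^esub> f j' k' y')} | i' x' j' y' k'.
          (i', x') \<in> R `` {(i, x)} \<and> (j', y') \<in> R `` {(j, y)} \<and> k' \<in> I \<and> leq i' k' \<and> leq j' k'}"
      using k by blast
  next
    fix S assume "S \<in> {R `` {(k', f i' k' x' \<otimes>\<^bsub>D k'\<^esub> f j' k' y')} | i' x' j' y' k'.
          (i', x') \<in> R `` {(i, x)} \<and> (j', y') \<in> R `` {(j, y)} \<and> k' \<in> I \<and> leq i' k' \<and> leq j' k'}"
    then obtain i' x' j' y' k' where S: "S = R `` {(k', f i' k' x' \<otimes>\<^bsub>D k'\<^esub> f j' k' y')}"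
      and "((i, x), (i', x')) \<in> R" "((j, y), (j', y')) \<in> R" "k' \<in> I" "leq i' k'" "leq j' k'"
      by blast
    then show "S \<in> {R `` {(k, f i k x \<otimes>\<^bsub>D k\<^esub> f j k y)}}"
      using eq by blast
  qed
  then show ?thesis by (simp add: direct_limit_def)
qed

lemma carrier_direct_limitE:
  assumes "A \<in> carrier L"
  obtains i x where "i \<in> I" "x \<in> carrier (D i)" "A = R `` {(i, x)}"
  using assms by (auto simp: carrier_direct_limit)

lemma group_direct_limit: "group L"
proof -
  have push: "\<exists>x' \<in> carrier (D k). A = R `` {(k, x')}"
    if "A = R `` {(i, x)}" "i \<in> I" "x \<in> carrier (D i)" "k \<in> I" "leq i k" for A i x k
    using that class_push[of i x k] f_closed[of i k x] by auto
  have common2: "\<exists>k \<in> I. \<exists>x \<in> carrier (D k). \<exists>y \<in> carrier (D k). A = R `` {(k, x)} \<and> B = R `` {(k, y)}"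
    if A: "A \<in> carrier L" and B: "B \<in> carrier L" for A B
  proof -
    obtain i x where i: "i \<in> I" "x \<in> carrier (D i)" "A = R `` {(i, x)}"
      using A by (rule carrier_direct_limitE)
    obtain j y where j: "j \<in> I" "y \<in> carrier (D j)" "B = R `` {(j, y)}"
      using B by (rule carrier_direct_limitE)
    obtain k where k: "k \<in> I" "leq i k" "leq j k" using directed i j by blast
    show ?thesis using push[OF i(3,1,2) k(1,2)] push[OF j(3,1,2) k(1,3)] k(1) by blast
  qed
  have mult: "R `` {(k, x)} \<otimes>\<^bsub>L\<^esub> R `` {(k, y)} = R `` {(k, x \<otimes>\<^bsub>D k\<^esub> y)}"
    if "k \<in> I" "x \<in> carrier (D k)" "y \<in> carrier (D k)" for k x y
    using mult_direct_limit[of k x k y k] that le_refl f_refl by simp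
  have mem: "R `` {(k, x)} \<in> carrier L" if "k \<in> I" "x \<in> carrier (D k)" for k x
    using that by (auto simp: carrier_direct_limit)
  show ?thesis
  proof (rule groupI)
    show "\<one>\<^bsub>L\<^esub> \<in> carrier L"
      using nonempty one_direct_limit mem one_closed_D by fastforce
  next
    fix A B assume "A \<in> carrier L" "B \<in> carrier L"
    then obtain k x y where "k \<in> I" "x \<in> carrier (D k)" "y \<in> carrier (D k)"
      "A = R `` {(k, x)}" "B = R `` {(k, y)}" using common2[of A B] by blast
    then show "A \<otimes>\<^bsub>L\<^esub> B \<in> carrier L"
      by (simp add: mult mem mult_closed_D)
  next
    fix A B C assume A: "A \<in> carrier L" and B: "B \<in> carrier L" and C: "C \<in> carrier L"
    obtain k x y where k: "k \<in> I" "x \<in> carrier (D k)" "y \<in> carrier (D k)"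
      "A = R `` {(k, x)}" "B = R `` {(k, y)}" using common2[OF A B] by blast
    obtain j z where j: "j \<in> I" "z \<in> carrier (D j)" "C = R `` {(j, z)}"
      using C by (rule carrier_direct_limitE)
    obtain l where l: "l \<in> I" "leq k l" "leq j l" using directed k j by blast
    obtain x' y' z' where "x' \<in> carrier (D l)" "y' \<in> carrier (D l)" "z' \<in> carrier (D l)"
      "A = R `` {(l, x')}" "B = R `` {(l, y')}" "C = R `` {(l, z')}"
      using push[OF k(4,1,2) l(1,2)] push[OF k(5,1,3) l(1,2)] push[OF j(3,1,2) l(1,3)] by blast
    then show "A \<otimes>\<^bsub>L\<^esub> B \<otimes>\<^bsub>L\<^esub> C = A \<otimes>\<^bsub>L\<^esub> (B \<otimes>\<^bsub>L\<^esub> C)"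
      using l group_D[of l] by (simp add: mult group.is_monoid monoid.m_closed monoid.m_assoc)
  next
    fix A assume "A \<in> carrier L"
    then obtain i x where "i \<in> I" "x \<in> carrier (D i)" "A = R `` {(i, x)}"
      by (rule carrier_direct_limitE)
    then show "\<one>\<^bsub>L\<^esub> \<otimes>\<^bsub>L\<^esub> A = A"
      using group_D[of i] one_closed_D[of i]
      by (simp add: one_direct_limit[of i] mult group.is_monoid monoid.l_one)
  next
    fix A assume "A \<in> carrier L"
    then obtain i x where i: "i \<in> I" "x \<in> carrier (D i)" "A = R `` {(i, x)}"
      by (rule carrier_direct_limitE)
    then have "R `` {(i, inv\<^bsub>D i\<^esub> x)} \<otimes>\<^bsub>L\<^esub> A = \<one>\<^bsub>L\<^esub>"
      using group_D[of i] by (simp add: one_direct_limit[of i] mult group.l_inv group.inv_closed)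
    then show "\<exists>B \<in> carrier L. B \<otimes>\<^bsub>L\<^esub> A = \<one>\<^bsub>L\<^esub>"
      using i mem group.inv_closed[OF group_D[of i]] by blast
  qed
qed

end


section \<open>Closure under the elementary operations\<close>

text \<open>Classes of groups are isomorphism-invariant predicates on the groups carried by subsets of a
  universe type \<open>'u\<close>, which also supplies the index sets of the directed systems. A group of
  another type belongs to the class if it is isomorphic to a group over some universe that does.
  A statement about the whole class thus has to be made for every universe \<open>'u\<close>.

  Quotients and limits are formed on other types, and therefore appear only up to isomorphism.\<close>

inductive elementary_closure :: "('u monoid \<Rightarrow> bool) \<Rightarrow> 'u monoid \<Rightarrow> bool"
  for C :: "'u monoid \<Rightarrow> bool" where
  base: "C G \<Longrightarrow> elementary_closure C G"
| isomorphic: "\<lbrakk>elementary_closure C G; group H; H \<cong> G\<rbrakk> \<Longrightarrow> elementary_closure C H"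
| subgroup: "\<lbrakk>elementary_closure C G; subgroup H G\<rbrakk> \<Longrightarrow> elementary_closure C (G\<lparr>carrier := H\<rparr>)"
| quotient: "\<lbrakk>elementary_closure C G; N \<lhd> G; group Q; Q \<cong> G Mod N\<rbrakk> \<Longrightarrow> elementary_closure C Q"
| extension: "\<lbrakk>group G; N \<lhd> G; elementary_closure C (G\<lparr>carrier := N\<rparr>);
               elementary_closure C Q; Q \<cong> G Mod N\<rbrakk> \<Longrightarrow> elementary_closure C G"
| limit: "\<lbrakk>directed_system (I :: 'u set) leq D f; \<And>i. i \<in> I \<Longrightarrow> elementary_closure C (D i);
           group G; G \<cong> direct_limit I leq D f\<rbrakk> \<Longrightarrow> elementary_closure C G"


section \<open>The first Grigorchuk group\<close>

text \<open>The vertices of the rooted binary tree are the words over \<open>{0, 1}\<close>, with \<open>False\<close> for 0 and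
  \<open>True\<close> for 1; the tree structure is the prefix order.\<close>

definition tree_aut_group :: "(bool list \<Rightarrow> bool list) monoid" where
  "tree_aut_group =
     \<lparr>carrier = {g. bij g \<and> (\<forall>u v. prefix u v \<longleftrightarrow> prefix (g u) (g v))},
      monoid.mult = (\<circ>), one = id\<rparr>"

fun grig_a :: "bool list \<Rightarrow> bool list" where
  "grig_a [] = []"
| "grig_a (x # v) = (\<not> x) # v"

fun grig_b grig_c grig_d :: "bool list \<Rightarrow> bool list" where
  "grig_b [] = []"
| "grig_b (False # v) = False # grig_a v"
| "grig_b (True # v) = True # grig_c v"
| "grig_c [] = []"
| "grig_c (False # v) = False # grig_a v"
| "grig_c (True # v) = True # grig_d v"
| "grig_d [] = []"
| "grig_d (False # v) = False # v"
| "grig_d (True # v) = True # grig_b v"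

definition grigorchuk_group :: "(bool list \<Rightarrow> bool list) monoid" where
  "grigorchuk_group =
     tree_aut_group\<lparr>carrier := generate tree_aut_group {grig_a, grig_b, grig_c, grig_d}\<rparr>"

lemma group_tree_aut_group: "group tree_aut_group"
proof (rule groupI)
  fix g assume g: "g \<in> carrier tree_aut_group"
  then have bij: "bij g" by (simp add: tree_aut_group_def)
  have "prefix u v \<longleftrightarrow> prefix (inv_into UNIV g u) (inv_into UNIV g v)" for u v
    using g bij_is_surj[OF bij] surj_f_inv_f[of g]
    by (metis (mono_tags, lifting) mem_Collect_eq partial_object.select_convs(1) tree_aut_group_def)
  then have "inv_into UNIV g \<in> carrier tree_aut_group"
    using bij by (simp add: tree_aut_group_def bij_imp_bij_inv)
  moreover have "inv_into UNIV g \<circ> g = id" using bij by (simp add: bij_is_inj)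
  ultimately show "\<exists>h \<in> carrier tree_aut_group. h \<otimes>\<^bsub>tree_aut_group\<^esub> g = \<one>\<^bsub>tree_aut_group\<^esub>"
    by (auto simp: tree_aut_group_def)
qed (auto simp: tree_aut_group_def bij_comp)

lemma grig_a_involution: "grig_a (grig_a v) = v"
  by (cases v) auto

lemma grig_bcd_involution:
  "grig_b (grig_b v) = v" "grig_c (grig_c v) = v" "grig_d (grig_d v) = v"
  by (induction v and v and v rule: grig_b_grig_c_grig_d.induct) (auto simp: grig_a_involution)

lemma grig_a_prefix: "prefix u v \<Longrightarrow> prefix (grig_a u) (grig_a v)"
  by (cases u; cases v) auto

lemma grig_bcd_prefix:
  "prefix u v \<Longrightarrow> prefix (grig_b u) (grig_b v)"
  "prefix u v \<Longrightarrow> prefix (grig_c u) (grig_c v)"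
  "prefix u v \<Longrightarrow> prefix (grig_d u) (grig_d v)"
  by (induction u and u and u arbitrary: v and v and v rule: grig_b_grig_c_grig_d.induct)
    (auto simp: prefix_Cons grig_a_prefix prefix_def[of "_ # _"] simp flip: prefix_def)

lemma involution_in_tree_aut_group:
  assumes "\<And>v. g (g v) = v" "\<And>u v. prefix u v \<Longrightarrow> prefix (g u) (g v)"
  shows "g \<in> carrier tree_aut_group"
  using assms unfolding tree_aut_group_def by (auto intro: involuntory_imp_bij) metis

lemma grig_generators_in_tree_aut_group:
  "{grig_a, grig_b, grig_c, grig_d} \<subseteq> carrier tree_aut_group"
  by (auto intro!: involution_in_tree_aut_group
      simp: grig_a_involution grig_bcd_involution grig_a_prefix grig_bcd_prefix)

lemma group_grigorchuk_group: "group grigorchuk_group"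
  unfolding grigorchuk_group_def
  by (intro group.subgroup_imp_group group_tree_aut_group group.generate_is_subgroup
      grig_generators_in_tree_aut_group)

end

(* Torsion: up to conjugation and merging of adjacent letters b, c, d, a word g has at most as many
   letters b, c, d as a. For suitable weights of the letters the two sections of such a word, which
   determine g or g^2, weigh together less than the word.

   Not elementary: call T involved in H if some subgroup of H maps onto T. If T is finitely
   generated and involved in each of its nontrivial normal subgroups, then the groups that do not
   involve T are closed under the elementary operations. For the Grigorchuk group this is so because
   the sections of a nontrivial normal subgroup N are normal again: some section swaps the two
   subtrees, so sections of N contain b, then a, then b, ac and ad, and finally all generators.
   The group has no finite exponent, so no group of bounded 2-torsion involves it. *)

theory Submission
  imports Defs
begin

section \<open>Involved groups\<close>

text \<open>In other words, \<open>T\<close> is isomorphic to a subquotient of \<open>H\<close>. The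
  surjection is taken instead of a quotient group so that \<open>H\<close> and \<open>T\<close> can
  live on different types.\<close>

definition involves :: "('a, 'c) monoid_scheme \<Rightarrow> ('b, 'd) monoid_scheme \<Rightarrow> bool" where
  "involves H T \<longleftrightarrow>
     (\<exists>K \<phi>. subgroup K H \<and> \<phi> \<in> hom (H\<lparr>carrier := K\<rparr>) T \<and> \<phi> ` K = carrier T)"

lemma involvesI:
  "\<lbrakk>subgroup K H; \<phi> \<in> hom (H\<lparr>carrier := K\<rparr>) T; \<phi> ` K = carrier T\<rbrakk> \<Longrightarrow> involves H T"
  by (auto simp: involves_def)

lemma involvesE:
  assumes "involves H T"
  obtains K \<phi> where "subgroup K H" "\<phi> \<in> hom (H\<lparr>carrier := K\<rparr>) T" "\<phi> ` K = carrier T"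
  using assms by (auto simp: involves_def)

lemma involves_subgroup:
  assumes "group G" "subgroup H G" "involves (G\<lparr>carrier := H\<rparr>) T"
  shows "involves G T"
proof -
  obtain K \<phi> where K: "subgroup K (G\<lparr>carrier := H\<rparr>)" "\<phi> \<in> hom (G\<lparr>carrier := K\<rparr>) T"
    "\<phi> ` K = carrier T"
    using assms(3) by (auto elim!: involvesE)
  have "subgroup K G" using group.incl_subgroup[OF assms(1,2) K(1)] .
  then show ?thesis using K by (intro involvesI)
qed

lemma subgroup_vimage:
  assumes "group G" "group H" "\<pi> \<in> hom G H" "subgroup K H"
  shows "subgroup {x \<in> carrier G. \<pi> x \<in> K} G"
proof -
  interpret group_hom G H \<pi> using assms by (simp add: group_hom_def group_hom_axioms_def)
  show ?thesis using assms(4)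
    by (intro G.subgroupI) (auto simp: subgroup.m_closed subgroup.m_inv_closed subgroup.one_closed
        intro!: exI[of _ "\<one>\<^bsub>G\<^esub>"])
qed

text \<open>The preimage of \<open>K\<close> under the surjection \<open>\<pi>\<close> maps onto
  \<open>K\<close>, and from there onto \<open>T\<close>.\<close>

lemma involves_pullback:
  assumes "group G" "group H" "\<pi> \<in> hom G H" "\<pi> ` carrier G = carrier H" "involves H T"
  shows "involves G T"
proof -
  obtain K \<phi> where K: "subgroup K H" "\<phi> \<in> hom (H\<lparr>carrier := K\<rparr>) T" "\<phi> ` K = carrier T"
    using assms(5) by (rule involvesE)
  let ?K = "{x \<in> carrier G. \<pi> x \<in> K}"
  have "\<pi> ` ?K = K"
  proof (intro equalityI subsetI)
    fix y assume "y \<in> K"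
    then have "y \<in> \<pi> ` carrier G" using assms(4) subgroup.subset[OF K(1)] by auto
    then show "y \<in> \<pi> ` ?K" using \<open>y \<in> K\<close> by blast
  qed auto
  then have "(\<phi> \<circ> \<pi>) ` ?K = carrier T" using K(3) by (metis image_comp)
  moreover have "\<phi> \<circ> \<pi> \<in> hom (G\<lparr>carrier := ?K\<rparr>) T"
    using K(2) assms(3) by (auto simp: hom_def)
  ultimately show ?thesis using subgroup_vimage[OF assms(1-3) K(1)] by (intro involvesI)
qed

lemma involves_iso_imp:
  assumes "group G" "group H" "G \<cong> H" "involves H T"
  shows "involves G T"
proof -
  obtain \<pi> where "\<pi> \<in> hom G H" "\<pi> ` carrier G = carrier H"
    using assms(3) by (auto simp: is_iso_def iso_def bij_betw_def)
  then show ?thesis using involves_pullback[OF assms(1,2) _ _ assms(4)] by blast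
qed

lemma involves_iso:
  assumes "group G" "group H" "G \<cong> H"
  shows "involves G T \<longleftrightarrow> involves H T"
  using involves_iso_imp[OF assms, of T]
    involves_iso_imp[OF assms(2,1) group.iso_sym[OF assms(1,3)], of T] by blast

text \<open>By \<open>ker\<close>, the map \<open>\<phi>\<close> is constant on the fibres of
  \<open>\<pi>\<close> in \<open>K\<close>, so it descends to the image of \<open>K\<close> and
  stays onto \<open>T\<close>.\<close>

lemma involves_pushforward:
  assumes "group G" "group H" "group T" "\<pi> \<in> hom G H" "subgroup K G"
    and \<phi>: "\<phi> \<in> hom (G\<lparr>carrier := K\<rparr>) T" "\<phi> ` K = carrier T"
    and ker: "\<And>x. \<lbrakk>x \<in> K; \<pi> x = \<one>\<^bsub>H\<^esub>\<rbrakk> \<Longrightarrow> \<phi> x = \<one>\<^bsub>T\<^esub>"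
  shows "involves H T"
proof -
  interpret G: group G by fact
  interpret H: group H by fact
  interpret T: group T by fact
  interpret \<pi>: group_hom G H \<pi> by unfold_locales fact
  interpret K: subgroup K G by fact
  interpret GK: group "G\<lparr>carrier := K\<rparr>" by (rule K.subgroup_is_group[OF \<open>group G\<close>])
  interpret \<phi>: group_hom "G\<lparr>carrier := K\<rparr>" T \<phi> by unfold_locales fact
  have inj: "\<phi> x = \<phi> y" if "x \<in> K" "y \<in> K" "\<pi> x = \<pi> y" for x y
  proof -
    have "\<pi> (x \<otimes>\<^bsub>G\<^esub> inv\<^bsub>G\<^esub> y) = \<one>\<^bsub>H\<^esub>" using that by simp
    then have "\<phi> (x \<otimes>\<^bsub>G\<^esub> inv\<^bsub>G\<^esub> y) = \<one>\<^bsub>T\<^esub>" using that by (intro ker) auto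
    moreover have "\<phi> (inv\<^bsub>G\<^esub> y) = inv\<^bsub>T\<^esub> \<phi> y"
      using \<phi>.hom_inv[of y] that G.m_inv_consistent[OF assms(5), of y] by simp
    ultimately have "\<phi> x \<otimes>\<^bsub>T\<^esub> inv\<^bsub>T\<^esub> \<phi> y = \<one>\<^bsub>T\<^esub>"
      using \<phi>.hom_mult[of x "inv\<^bsub>G\<^esub> y"] that by simp
    then show ?thesis using \<phi>.hom_closed[of x] \<phi>.hom_closed[of y] that
      by (simp add: T.inv_solve_right')
  qed
  \<comment> \<open>The descended map evaluates \<open>\<phi>\<close> at a chosen preimage;
    \<open>inj\<close> makes the choice immaterial.\<close>
  define \<psi> where "\<psi> z = \<phi> (inv_into K \<pi> z)" for z
  have \<psi>: "\<psi> (\<pi> x) = \<phi> x" if "x \<in> K" for x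
    unfolding \<psi>_def using that by (intro inj) (auto simp: inv_into_into f_inv_into_f)
  have "subgroup (\<pi> ` K) H" by (rule \<pi>.subgroup_img_is_subgroup[OF assms(5)])
  moreover have "\<psi> \<in> hom (H\<lparr>carrier := \<pi> ` K\<rparr>) T"
  proof (rule homI)
    fix x assume "x \<in> carrier (H\<lparr>carrier := \<pi> ` K\<rparr>)"
    then show "\<psi> x \<in> carrier T" using \<psi> \<phi>(2) by auto
  next
    fix x y assume "x \<in> carrier (H\<lparr>carrier := \<pi> ` K\<rparr>)" "y \<in> carrier (H\<lparr>carrier := \<pi> ` K\<rparr>)"
    then obtain u v where u: "u \<in> K" "v \<in> K" "x = \<pi> u" "y = \<pi> v" by auto
    have "\<psi> (\<pi> u \<otimes>\<^bsub>H\<^esub> \<pi> v) = \<psi> (\<pi> (u \<otimes>\<^bsub>G\<^esub> v))" using u by simp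
    also have "\<dots> = \<phi> (u \<otimes>\<^bsub>G\<^esub> v)" using u by (intro \<psi>) simp
    also have "\<dots> = \<phi> u \<otimes>\<^bsub>T\<^esub> \<phi> v" using \<phi>.hom_mult[of u v] u by simp
    finally show "\<psi> (x \<otimes>\<^bsub>H\<lparr>carrier := \<pi> ` K\<rparr>\<^esub> y) = \<psi> x \<otimes>\<^bsub>T\<^esub> \<psi> y" using u \<psi> by simp
  qed
  moreover have "\<psi> ` \<pi> ` K = carrier T" using \<psi> \<phi>(2) by (auto simp: image_image)
  ultimately show ?thesis by (rule involvesI)
qed

text \<open>Since \<open>\<phi>\<close> is onto, it sends \<open>K \<inter> N\<close> to a normal
  subgroup of \<open>T\<close>. If that image is trivial, \<open>\<phi>\<close> factors through
  \<open>G Mod N\<close>. Otherwise the image involves \<open>T\<close> by hypothesis, and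
  \<open>K \<inter> N\<close>, which maps onto it, lies in \<open>N\<close>.\<close>

lemma involves_extension:
  assumes "group G" "N \<lhd> G" "group T" "involves G T"
    and T: "\<And>M. \<lbrakk>M \<lhd> T; M \<noteq> {\<one>\<^bsub>T\<^esub>}\<rbrakk> \<Longrightarrow> involves (T\<lparr>carrier := M\<rparr>) T"
  shows "involves (G\<lparr>carrier := N\<rparr>) T \<or> involves (G Mod N) T"
proof -
  interpret G: group G by fact
  interpret T: group T by fact
  interpret N: normal N G by fact
  obtain K \<phi> where K: "subgroup K G" "\<phi> \<in> hom (G\<lparr>carrier := K\<rparr>) T" "\<phi> ` K = carrier T"
    using assms(4) by (rule involvesE)
  interpret K: subgroup K G by fact
  interpret GK: group "G\<lparr>carrier := K\<rparr>" by (rule K.subgroup_is_group[OF \<open>group G\<close>])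
  interpret \<phi>: group_hom "G\<lparr>carrier := K\<rparr>" T \<phi> using K(2) by unfold_locales
  have KN: "subgroup (K \<inter> N) (G\<lparr>carrier := K\<rparr>)" "subgroup (K \<inter> N) (G\<lparr>carrier := N\<rparr>)"
    using G.subgroups_Inter_pair[OF K(1) N.is_subgroup] K.subset N.subset
    by (auto intro!: G.subgroup_incl K(1) N.is_subgroup)
  have inv_eq: "inv\<^bsub>G\<lparr>carrier := K\<rparr>\<^esub> x = inv\<^bsub>G\<^esub> x" if "x \<in> K" for x
    using G.m_inv_consistent[OF K(1) that] .
  have sub: "subgroup (\<phi> ` (K \<inter> N)) T" by (rule \<phi>.subgroup_img_is_subgroup[OF KN(1)])
  have normal: "\<phi> ` (K \<inter> N) \<lhd> T"
  proof (rule T.normal_invI[OF sub])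
    fix x h assume "x \<in> carrier T" "h \<in> \<phi> ` (K \<inter> N)"
    moreover from this obtain u where "u \<in> K" "x = \<phi> u" using K(3) by auto
    ultimately obtain n where u: "u \<in> K" "x = \<phi> u" "n \<in> K" "n \<in> N" "h = \<phi> n" by auto
    have "x \<otimes>\<^bsub>T\<^esub> h \<otimes>\<^bsub>T\<^esub> inv\<^bsub>T\<^esub> x = \<phi> (u \<otimes>\<^bsub>G\<^esub> n \<otimes>\<^bsub>G\<^esub> inv\<^bsub>G\<^esub> u)"
      using u \<phi>.hom_mult[of u n] \<phi>.hom_mult[of "u \<otimes>\<^bsub>G\<^esub> n" "inv\<^bsub>G\<^esub> u"] \<phi>.hom_inv[of u] inv_eq[of u]
      by simp
    moreover have "u \<otimes>\<^bsub>G\<^esub> n \<otimes>\<^bsub>G\<^esub> inv\<^bsub>G\<^esub> u \<in> K \<inter> N"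
      using u N.inv_op_closed2[of u n] K.mem_carrier by simp
    ultimately show "x \<otimes>\<^bsub>T\<^esub> h \<otimes>\<^bsub>T\<^esub> inv\<^bsub>T\<^esub> x \<in> \<phi> ` (K \<inter> N)" by blast
  qed
  show ?thesis
  proof (cases "\<phi> ` (K \<inter> N) = {\<one>\<^bsub>T\<^esub>}")
    case True
    have "\<phi> x = \<one>\<^bsub>T\<^esub>" if "x \<in> K" "N #>\<^bsub>G\<^esub> x = \<one>\<^bsub>G Mod N\<^esub>" for x
    proof -
      have "x \<in> N" using that G.rcos_self[of x N] N.is_subgroup K.mem_carrier
        by (auto simp: FactGroup_def)
      then show ?thesis using True that by blast
    qed
    then have "involves (G Mod N) T"
      by (rule involves_pushforward[OF \<open>group G\<close> N.factorgroup_is_group \<open>group T\<close>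
            N.r_coset_hom_Mod K])
    then show ?thesis ..
  next
    case False
    then have "involves (T\<lparr>carrier := \<phi> ` (K \<inter> N)\<rparr>) T" using normal T by blast
    moreover have "\<phi> \<in> hom (G\<lparr>carrier := K \<inter> N\<rparr>) (T\<lparr>carrier := \<phi> ` (K \<inter> N)\<rparr>)"
      using K(2) by (auto simp: hom_def)
    moreover have "group (G\<lparr>carrier := K \<inter> N\<rparr>)"
      using G.subgroups_Inter_pair[OF K(1) N.is_subgroup] by (rule G.subgroup_imp_group)
    ultimately have "involves (G\<lparr>carrier := K \<inter> N\<rparr>) T"
      using T.subgroup_imp_group[OF sub]
      by (intro involves_pullback[where \<pi> = \<phi> and H = "T\<lparr>carrier := \<phi> ` (K \<inter> N)\<rparr>"]) simp_all
    then show ?thesis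
      using involves_subgroup[OF G.subgroup_imp_group[OF N.is_subgroup] KN(2), of T] by simp
  qed
qed

section \<open>Direct limits and finitely generated subquotients\<close>

context directed_system begin

lemma hom_to_limit:
  assumes "k \<in> I"
  shows "(\<lambda>x. R `` {(k, x)}) \<in> hom (D k) L"
proof (rule homI)
  fix x y assume "x \<in> carrier (D k)" "y \<in> carrier (D k)"
  then show "R `` {(k, x \<otimes>\<^bsub>D k\<^esub> y)} = R `` {(k, x)} \<otimes>\<^bsub>L\<^esub> R `` {(k, y)}"
    using mult_direct_limit[of k x k y k] assms le_refl f_refl by simp
qed (use assms in \<open>auto simp: carrier_direct_limit\<close>)

text \<open>Directedness allows the representatives found so far and the new one to be pushed to a
  common later index.\<close>

lemma finite_common_index:
  assumes "finite F" "F \<subseteq> carrier L"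
  shows "\<exists>k \<in> I. F \<subseteq> (\<lambda>x. R `` {(k, x)}) ` carrier (D k)"
  using assms
proof (induction F rule: finite_induct)
  case empty
  then show ?case using nonempty by auto
next
  case (insert A F)
  then obtain j where j: "j \<in> I" "F \<subseteq> (\<lambda>x. R `` {(j, x)}) ` carrier (D j)" by auto
  obtain i x where i: "i \<in> I" "x \<in> carrier (D i)" "A = R `` {(i, x)}"
    using insert.prems by (auto elim: carrier_direct_limitE)
  obtain k where k: "k \<in> I" "leq i k" "leq j k" using directed i j by blast
  have push: "R `` {(l, y)} \<in> (\<lambda>x. R `` {(k, x)}) ` carrier (D k)"
    if "l \<in> I" "y \<in> carrier (D l)" "leq l k" for l y
    using class_push[of l y k] f_closed[of l k y] that k by blast
  show ?case using i j k push by (intro bexI[of _ k]) auto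
qed

text \<open>Preimages of the finitely many generators all have representatives at one index
  \<open>k\<close>. The part of \<open>D k\<close> lying over \<open>K\<close> then maps to a
  subgroup of \<open>T\<close> that contains the generators, hence onto \<open>T\<close>.\<close>

lemma involves_direct_limit:
  assumes "group T" "finite S" "S \<subseteq> carrier T" "generate T S = carrier T" "involves L T"
  shows "\<exists>i \<in> I. involves (D i) T"
proof -
  interpret T: group T by fact
  obtain K \<phi> where K: "subgroup K L" "\<phi> \<in> hom (L\<lparr>carrier := K\<rparr>) T" "\<phi> ` K = carrier T"
    using assms(5) by (rule involvesE)
  obtain F where F: "F \<subseteq> K" "finite F" "S = \<phi> ` F"
    using finite_subset_image[OF assms(2), of \<phi> K] assms(3) K(3) by auto
  have "F \<subseteq> carrier L" using F subgroup.subset[OF K(1)] by auto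
  then obtain k where k: "k \<in> I" "F \<subseteq> (\<lambda>x. R `` {(k, x)}) ` carrier (D k)"
    using finite_common_index[OF F(2)] by auto
  define \<pi> where "\<pi> = (\<lambda>x. R `` {(k, x)})"
  have \<pi>: "\<pi> \<in> hom (D k) L" unfolding \<pi>_def by (rule hom_to_limit[OF k(1)])
  define K' where "K' = {x \<in> carrier (D k). \<pi> x \<in> K}"
  have sub: "subgroup K' (D k)"
    unfolding K'_def using subgroup_vimage[OF group_D[OF k(1)] group_direct_limit \<pi> K(1)] .
  have hom: "\<phi> \<circ> \<pi> \<in> hom (D k\<lparr>carrier := K'\<rparr>) T"
    using K(2) \<pi> by (auto simp: hom_def K'_def)
  interpret \<phi>\<pi>: group_hom "D k\<lparr>carrier := K'\<rparr>" T "\<phi> \<circ> \<pi>"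
    using hom group.subgroup_imp_group[OF group_D[OF k(1)] sub] \<open>group T\<close>
    by (simp add: group_hom_def group_hom_axioms_def)
  have "S \<subseteq> (\<phi> \<circ> \<pi>) ` K'"
    using F k(2) by (fastforce simp: K'_def \<pi>_def)
  then have "generate T S \<subseteq> (\<phi> \<circ> \<pi>) ` K'"
    using \<phi>\<pi>.img_is_subgroup by (intro T.generate_subgroup_incl) auto
  moreover have "(\<phi> \<circ> \<pi>) ` K' \<subseteq> carrier T" using \<phi>\<pi>.hom_closed by auto
  ultimately have "(\<phi> \<circ> \<pi>) ` K' = carrier T" using assms(4) by auto
  then have "involves (D k) T" by (rule involvesI[OF sub hom])
  then show ?thesis using k(1) by blast
qed

end

text \<open>Rule induction with one of the preceding lemmas for each operation. Being a group is
  carried along because those lemmas require it of the groups they compare.\<close>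

theorem elementary_closure_not_involves:
  fixes T :: "('a, 'b) monoid_scheme"
  assumes "group T" "finite S" "S \<subseteq> carrier T" "generate T S = carrier T"
    and T: "\<And>M. \<lbrakk>M \<lhd> T; M \<noteq> {\<one>\<^bsub>T\<^esub>}\<rbrakk> \<Longrightarrow> involves (T\<lparr>carrier := M\<rparr>) T"
    and C: "\<And>G. C G \<Longrightarrow> group G \<and> \<not> involves G T"
    and G: "elementary_closure C G"
  shows "group G \<and> \<not> involves G T"
  using G
proof induction
  case (base G)
  then show ?case by (rule C)
next
  case (isomorphic G H)
  then show ?case using involves_iso[OF isomorphic.hyps(2) _ isomorphic.hyps(3), of T] by blast
next
  case (subgroup G H)
  then have "group G" "\<not> involves G T" by auto
  then show ?case
    using involves_subgroup[OF _ subgroup.hyps(2)] group.subgroup_imp_group[OF _ subgroup.hyps(2)]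
    by blast
next
  case (quotient G N Q)
  interpret N: normal N G by fact
  have "(\<lambda>a. N #>\<^bsub>G\<^esub> a) ` carrier G = carrier (G Mod N)"
    by (auto simp: FactGroup_def RCOSETS_def)
  then have "\<not> involves (G Mod N) T"
    using involves_pullback[OF _ N.factorgroup_is_group N.r_coset_hom_Mod] quotient.IH by blast
  then show ?case
    using involves_iso[OF quotient.hyps(3) N.factorgroup_is_group quotient.hyps(4)] quotient.hyps(3)
    by blast
next
  case (extension G N Q)
  have "\<not> involves (G Mod N) T"
    using involves_iso[OF _ normal.factorgroup_is_group[OF extension.hyps(2)] extension.hyps(5)]
      extension.IH(2) by blast
  then have "\<not> involves G T"
    using involves_extension[OF extension.hyps(1,2) assms(1) _ T] extension.IH(1) by blast
  then show ?case using extension.hyps(1) by blast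
next
  case (limit I leq D f G)
  interpret directed_system I leq D f by fact
  have "\<not> involves L T"
    using involves_direct_limit[OF assms(1-4)] limit.IH by blast
  then show ?case
    using involves_iso[OF limit.hyps(3) group_direct_limit limit.hyps(4)] limit.hyps(3) by blast
qed


section \<open>Words in the generators\<close>

text \<open>Formal words are kept apart from the maps they define because weights and letter counts
  depend on the word. No inverse letters occur, the generators being involutions.\<close>

datatype letter = A | B | C | D

fun letter_map :: "letter \<Rightarrow> bool list \<Rightarrow> bool list" where
  "letter_map A = grig_a"
| "letter_map B = grig_b"
| "letter_map C = grig_c"
| "letter_map D = grig_d"

fun letter_section :: "letter \<Rightarrow> bool \<Rightarrow> letter list" where
  "letter_section A x = []"
| "letter_section B x = (if x then [C] else [A])"
| "letter_section C x = (if x then [D] else [A])"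
| "letter_section D x = (if x then [B] else [])"

primrec word_map :: "letter list \<Rightarrow> bool list \<Rightarrow> bool list" where
  "word_map [] = id"
| "word_map (l # w) = letter_map l \<circ> word_map w"

text \<open>Only \<open>a\<close> moves the first level, so the parity decides whether the word
  swaps the two subtrees.\<close>

definition flips :: "letter list \<Rightarrow> bool" where
  "flips w \<longleftrightarrow> odd (count_list w A)"

text \<open>Words act from the right: \<open>w\<close> moves the child \<open>x\<close> before
  \<open>l\<close> acts, so \<open>l\<close> contributes its section at the moved child.\<close>

primrec word_section :: "letter list \<Rightarrow> bool \<Rightarrow> letter list" where
  "word_section [] x = []"
| "word_section (l # w) x = letter_section l (x \<noteq> flips w) @ word_section w x"

lemma letter_map_Cons:
  "letter_map l (x # v) = (x \<noteq> (l = A)) # word_map (letter_section l x) v"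
  by (cases l; cases x) auto

lemma letter_map_Nil [simp]: "letter_map l [] = []"
  by (cases l) auto

lemma letter_map_involution [simp]: "letter_map l (letter_map l v) = v"
  by (cases l) (auto simp: grig_a_involution grig_bcd_involution)

lemma word_map_Nil [simp]: "word_map w [] = []"
  by (induction w) auto

lemma word_map_append [simp]: "word_map (u @ w) = word_map u \<circ> word_map w"
  by (induction u) auto

lemma word_map_Cons_vertex:
  "word_map w (x # v) = (x \<noteq> flips w) # word_map (word_section w x) v"
  by (induction w) (auto simp: flips_def letter_map_Cons)

lemma word_map_rev [simp]: "word_map (rev w) (word_map w v) = v"
  by (induction w arbitrary: v) auto

lemma inj_word_map: "inj (word_map w)"
  by (rule inj_on_inverseI[of _ "word_map (rev w)"]) simp

section \<open>Torsion\<close>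

definition two_torsion :: "('a \<Rightarrow> 'a) \<Rightarrow> bool" where
  "two_torsion g \<longleftrightarrow> (\<exists>N::nat. g ^^ (2 ^ N) = id)"

lemma funpow_two_power_mono:
  assumes "g ^^ (2 ^ N) = id" "N \<le> M"
  shows "g ^^ (2 ^ M) = id"
proof -
  have "g ^^ (2 ^ M) = (g ^^ (2 ^ N)) ^^ (2 ^ (M - N))"
    using assms(2) by (simp add: funpow_mult flip: power_add)
  then show ?thesis using assms(1) by simp
qed

lemma comp_funpow_shift: "f \<circ> (g \<circ> f) ^^ n = (f \<circ> g) ^^ n \<circ> f"
  by (induction n) (simp_all add: fun_eq_iff)

text \<open>Cancel the injective \<open>f\<close> on the left in f (g f)^n = (f g)^n f. This serves
  to rotate words cyclically.\<close>

lemma two_torsion_commute: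
  assumes "two_torsion (f \<circ> g)" "inj f"
  shows "two_torsion (g \<circ> f)"
proof -
  obtain N :: nat where "(f \<circ> g) ^^ (2 ^ N) = id" using assms(1) by (auto simp: two_torsion_def)
  then have "f \<circ> (g \<circ> f) ^^ (2 ^ N) = f \<circ> id" using comp_funpow_shift[where f = f and g = g] by simp
  then have "f (((g \<circ> f) ^^ (2 ^ N)) v) = f v" for v by (metis comp_apply id_apply)
  then have "(g \<circ> f) ^^ (2 ^ N) = id" using assms(2) by (auto simp: inj_eq)
  then show ?thesis by (auto simp: two_torsion_def)
qed

lemma two_torsion_square:
  fixes g :: "'a \<Rightarrow> 'a"
  shows "two_torsion (g \<circ> g) \<Longrightarrow> two_torsion g"
proof -
  assume "two_torsion (g \<circ> g)"
  then obtain N :: nat where "(g \<circ> g) ^^ (2 ^ N) = id" by (auto simp: two_torsion_def)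
  moreover have "(g \<circ> g) ^^ (2 ^ N) = g ^^ (2 ^ Suc N)"
    using funpow_mult[where m = 2 and f = g and n = "2 ^ N"] by (simp add: numeral_2_eq_2 mult.commute)
  ultimately show "two_torsion g" unfolding two_torsion_def by metis
qed

text \<open>Powers of \<open>g\<close> are computed separately on the two subtrees, so the larger of
  the two exponents works for both.\<close>

lemma two_torsion_sections:
  fixes g :: "bool list \<Rightarrow> bool list"
  assumes "g [] = []" "\<And>x v. g (x # v) = x # s x v" "\<And>x. two_torsion (s x)"
  shows "two_torsion g"
proof -
  have pow: "(g ^^ n) (x # v) = x # (s x ^^ n) v" "(g ^^ n) [] = []" for n x v
    by (induction n) (auto simp: assms(1,2))
  obtain N M :: nat where N: "s False ^^ (2 ^ N) = id" "s True ^^ (2 ^ M) = id"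
    using assms(3)[of False] assms(3)[of True] unfolding two_torsion_def by blast
  have "s x ^^ (2 ^ max N M) = id" for x
    using N[THEN funpow_two_power_mono, of "max N M"] by (cases x) auto
  then have "(g ^^ (2 ^ max N M)) v = v" for v by (cases v) (simp_all add: pow)
  then show ?thesis unfolding two_torsion_def by (metis eq_id_iff)
qed

text \<open>With these weights the product of two of \<open>b\<close>, \<open>c\<close>, \<open>d\<close> is lighter than the two factors, and the
  two sections of \<open>b\<close>, \<open>c\<close> or \<open>d\<close> together exceed the letter by only 2, less than the weight of \<open>a\<close>,
  whose sections are empty. So words with at most as many other letters as \<open>a\<close>'s contract.\<close>

fun letter_weight :: "letter \<Rightarrow> nat" where
  "letter_weight A = 3"
| "letter_weight B = 4"
| "letter_weight C = 3"
| "letter_weight D = 2"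

definition word_weight :: "letter list \<Rightarrow> nat" where
  "word_weight w = (\<Sum>l\<leftarrow>w. letter_weight l)"

lemma word_weight_simps [simp]:
  "word_weight [] = 0"
  "word_weight (l # w) = letter_weight l + word_weight w"
  "word_weight (u @ w) = word_weight u + word_weight w"
  by (simp_all add: word_weight_def)

definition others :: "letter list \<Rightarrow> nat" where
  "others w = length (filter (\<lambda>l. l \<noteq> A) w)"

text \<open>Counted letter by letter: the sections of \<open>A\<close> are empty and lose its weight
  3, while the two sections of any other letter outweigh it by 2.\<close>

lemma word_weight_sections:
  "word_weight (word_section w False) + word_weight (word_section w True) + 3 * count_list w A
     = word_weight w + 2 * others w"
proof (induction w)
  case (Cons l w)
  \<comment> \<open>The parity \<open>p\<close> only exchanges the two summands.\<close>
  have "word_weight (letter_section l (False \<noteq> p)) + word_weight (letter_section l (True \<noteq> p))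
      + (if l = A then 3 else 0) = letter_weight l + (if l = A then 0 else 2)" for p
    by (cases l; cases p) auto
  from this[of "flips w"] Cons show ?case by (auto simp: others_def)
qed (simp add: others_def)

definition adjacent_others :: "letter list \<Rightarrow> bool" where
  "adjacent_others w \<longleftrightarrow> (\<exists>u x y v. w = u @ x # y # v \<and> x \<noteq> A \<and> y \<noteq> A)"

lemma adjacent_others_Cons: "adjacent_others w \<Longrightarrow> adjacent_others (l # w)"
  unfolding adjacent_others_def by (metis append_Cons)

lemma adjacent_others_Cons2: "\<lbrakk>x \<noteq> A; y \<noteq> A\<rbrakk> \<Longrightarrow> adjacent_others (x # y # w)"
  unfolding adjacent_others_def by (metis append_Nil)

text \<open>Without adjacent letters from b, c, d, any two of them are separated by an
  \<open>A\<close>, so they outnumber the \<open>A\<close>'s by at most one.\<close>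

lemma others_le_count_or_adjacent:
  "others w \<le> Suc (count_list w A) \<or> adjacent_others w"
proof (induction w rule: induct_list012)
  case (3 x y w)
  consider "x = A" | "x \<noteq> A" "y = A" | "x \<noteq> A" "y \<noteq> A" by blast
  then show ?case
  proof cases
    case 1
    then show ?thesis using 3(2) adjacent_others_Cons[of "y # w" x] by (auto simp: others_def)
  next
    case 2
    then show ?thesis
      using 3(1) adjacent_others_Cons[of w y] adjacent_others_Cons[of "y # w" x]
      by (auto simp: others_def)
  next
    case 3
    then show ?thesis by (simp add: adjacent_others_Cons2)
  qed
qed (auto simp: others_def)

text \<open>Together with the identity, b, c, d form a Klein four-group. The six products are proved
  simultaneously because passing to the right subtree permutes b, c, d cyclically.\<close>

lemma grig_bcd_product:
  "grig_b (grig_c v) = grig_d v" "grig_c (grig_b v) = grig_d v"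
  "grig_c (grig_d v) = grig_b v" "grig_d (grig_c v) = grig_b v"
  "grig_b (grig_d v) = grig_c v" "grig_d (grig_b v) = grig_c v"
proof (induction v)
  case (Cons x v)
  {
    case 1 then show ?case using Cons by (cases x) (auto simp: grig_a_involution)
  next
    case 2 then show ?case using Cons by (cases x) (auto simp: grig_a_involution)
  next
    case 3 then show ?case using Cons by (cases x) auto
  next
    case 4 then show ?case using Cons by (cases x) auto
  next
    case 5 then show ?case using Cons by (cases x) auto
  next
    case 6 then show ?case using Cons by (cases x) auto
  }
qed auto

lemma merge_letters:
  assumes "x \<noteq> A" "y \<noteq> A"
  shows "\<exists>w. word_map w = letter_map x \<circ> letter_map y \<and>
    word_weight w < letter_weight x + letter_weight y"
proof -
  \<comment> \<open>Equal letters cancel; for distinct ones the filter leaves exactly the third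
    letter.\<close>
  define w where "w = (if x = y then [] else filter (\<lambda>l. l \<notin> {A, x, y}) [B, C, D])"
  have "word_map w = letter_map x \<circ> letter_map y"
    using assms by (cases x; cases y) (simp_all add: w_def fun_eq_iff grig_bcd_involution grig_bcd_product)
  moreover have "word_weight w < letter_weight x + letter_weight y"
    using assms by (cases x; cases y) (simp_all add: w_def)
  ultimately show ?thesis by blast
qed

lemma two_torsion_adjacent:
  assumes IH: "\<And>w'. word_weight w' < word_weight w \<Longrightarrow> two_torsion (word_map w')"
    and "adjacent_others w"
  shows "two_torsion (word_map w)"
proof -
  obtain u x y v where w: "w = u @ x # y # v" "x \<noteq> A" "y \<noteq> A"
    using assms(2) by (auto simp: adjacent_others_def)
  obtain m where m: "word_map m = letter_map x \<circ> letter_map y"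
    "word_weight m < letter_weight x + letter_weight y"
    using merge_letters[OF w(2,3)] by blast
  have "two_torsion (word_map (u @ m @ v))" using m(2) by (intro IH) (simp add: w)
  also have "word_map (u @ m @ v) = word_map w" by (simp add: m(1) w comp_assoc)
  finally show ?thesis .
qed

text \<open>By the weight identity the two sections together weigh at most the weight of
  \<open>w\<close> minus the number of \<open>A\<close>'s, which is positive. If \<open>w\<close>
  fixes both children, its sections decide; if it swaps them, those of its square do.\<close>

lemma two_torsion_contract:
  assumes IH: "\<And>w'. word_weight w' < word_weight w \<Longrightarrow> two_torsion (word_map w')"
    and w: "others w \<le> count_list w A" "A \<in> set w"
  shows "two_torsion (word_map w)"
proof -
  have "count_list w A > 0" using w(2) by (simp add: count_list_0_iff zero_less_iff_neq_zero)
  then have less: "word_weight (word_section w False) + word_weight (word_section w True) < word_weight w"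
    using word_weight_sections[of w] w(1) by linarith
  show ?thesis
  proof (cases "flips w")
    case False
    have sections: "two_torsion (word_map (word_section w x))" for x
      by (rule IH) (use less in \<open>cases x; simp\<close>)
    show ?thesis
      by (rule two_torsion_sections[OF _ _ sections]) (use False in \<open>simp_all add: word_map_Cons_vertex\<close>)
  next
    case True
    \<comment> \<open>The square carries the subtree at \<open>x\<close> to the other child and
      back, so its section there is the product of both sections of \<open>w\<close>.\<close>
    have sections: "two_torsion (word_map (word_section w (\<not> x) @ word_section w x))" for x
      by (rule IH) (use less in \<open>cases x; simp\<close>)
    have "two_torsion (word_map w \<circ> word_map w)"
      by (rule two_torsion_sections[OF _ _ sections]) (use True in \<open>simp_all add: word_map_Cons_vertex\<close>)
    then show ?thesis by (rule two_torsion_square)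
  qed
qed

text \<open>Induction on weight: a word with adjacent letters from b, c, d is shortened in weight by
  merging them, and any other word containing \<open>A\<close> contracts after a rotation. What
  remains are words of length at most one.\<close>

lemma two_torsion_word_map: "two_torsion (word_map w)"
proof (induction w rule: measure_induct_rule[of word_weight])
  case (less w)
  show ?case
  proof (cases "A \<in> set w")
    case True
    then obtain u v where w: "w = u @ A # v" by (meson split_list)
    \<comment> \<open>Rotating an \<open>A\<close> to the front keeps the weight; this extra
      \<open>A\<close> absorbs the possible excess of one in \<open>v @ u\<close>.\<close>
    define w' where "w' = A # v @ u"
    have IH: "two_torsion (word_map w'')" if "word_weight w'' < word_weight w'" for w''
      using that less by (simp add: w w'_def)
    have "two_torsion (word_map w')"
      using others_le_count_or_adjacent[of "v @ u"]
    proof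
      assume "others (v @ u) \<le> Suc (count_list (v @ u) A)"
      then show ?thesis by (intro two_torsion_contract[OF IH]) (auto simp: w'_def others_def)
    next
      assume "adjacent_others (v @ u)"
      then have "adjacent_others w'" unfolding w'_def by (rule adjacent_others_Cons)
      then show ?thesis using IH two_torsion_adjacent by blast
    qed
    then have "two_torsion (word_map (A # v) \<circ> word_map u)" by (simp add: w'_def comp_assoc)
    then have "two_torsion (word_map u \<circ> word_map (A # v))"
      using inj_word_map by (rule two_torsion_commute)
    then show ?thesis by (simp only: w word_map_append)
  next
    case False
    show ?thesis
      using others_le_count_or_adjacent[of w]
    proof
      assume "others w \<le> Suc (count_list w A)"
      moreover have "filter (\<lambda>l. l \<noteq> A) w = w" using False by (auto intro: filter_True)
      ultimately have "length w \<le> 1" using False by (simp add: others_def count_list_0_iff)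
      then have "word_map w \<circ> word_map w = id" by (cases w) (auto simp: fun_eq_iff)
      then have "word_map w ^^ (2 ^ 1) = id" by (simp add: numeral_2_eq_2)
      then show ?thesis unfolding two_torsion_def by blast
    next
      assume "adjacent_others w"
      then show ?thesis using two_torsion_adjacent less.IH by blast
    qed
  qed
qed


section \<open>The group of word maps\<close>

text \<open>Every generator is its own inverse, so products of generators already give the generated
  subgroup.\<close>

lemma carrier_grigorchuk_group: "carrier grigorchuk_group = range word_map"
proof -
  interpret T: group tree_aut_group by (rule group_tree_aut_group)
  have T_simps: "\<one>\<^bsub>tree_aut_group\<^esub> = id" "x \<otimes>\<^bsub>tree_aut_group\<^esub> y = x \<circ> y" for x y
    by (simp_all add: tree_aut_group_def)
  let ?S = "{grig_a, grig_b, grig_c, grig_d}"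
  have S: "?S = range letter_map"
  proof -
    have "(UNIV :: letter set) = {A, B, C, D}" using letter.exhaust by blast
    then have "range letter_map = letter_map ` {A, B, C, D}" by (rule arg_cong)
    then show ?thesis by simp
  qed
  have "g \<in> range word_map" if "g \<in> generate tree_aut_group ?S" for g
    using that
  proof (induction rule: generate.induct)
    case one
    have "id = word_map []" by simp
    then show ?case unfolding T_simps by (rule range_eqI)
  next
    case (incl h)
    then obtain l where "h = letter_map l" unfolding S by blast
    then show ?case by (auto intro: range_eqI[of _ _ "[l]"])
  next
    case (inv h)
    then obtain l where l: "h = letter_map l" unfolding S by blast
    have "h \<in> carrier tree_aut_group" using inv grig_generators_in_tree_aut_group by blast
    then have "inv\<^bsub>tree_aut_group\<^esub> h = h"
      by (intro T.inv_equality) (simp_all add: T_simps l fun_eq_iff)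
    then show ?case using l by (auto intro: range_eqI[of _ _ "[l]"])
  next
    case (eng g h)
    then obtain u v where "g = word_map u" "h = word_map v" by auto
    then show ?case by (intro range_eqI[of _ _ "u @ v"]) (simp add: T_simps)
  qed
  moreover have "word_map w \<in> generate tree_aut_group ?S" for w
  proof (induction w)
    case Nil
    show ?case using generate.one[of tree_aut_group] unfolding word_map.simps T_simps .
  next
    case (Cons l w)
    have "letter_map l \<in> generate tree_aut_group ?S" unfolding S by (intro generate.incl) simp
    from generate.eng[OF this Cons] show ?case unfolding T_simps word_map.simps .
  qed
  ultimately show ?thesis by (auto simp: grigorchuk_group_def)
qed

lemma word_map_in_grigorchuk_group [simp]: "word_map w \<in> carrier grigorchuk_group"
  by (simp add: carrier_grigorchuk_group)

lemma grig_generators_in_grigorchuk_group [simp]: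
  "grig_a \<in> carrier grigorchuk_group" "grig_b \<in> carrier grigorchuk_group"
  "grig_c \<in> carrier grigorchuk_group" "grig_d \<in> carrier grigorchuk_group"
  using word_map_in_grigorchuk_group[of "[A]"] word_map_in_grigorchuk_group[of "[B]"]
    word_map_in_grigorchuk_group[of "[C]"] word_map_in_grigorchuk_group[of "[D]"] by simp_all

interpretation grig: group grigorchuk_group
  by (rule group_grigorchuk_group)

lemma grig_mult [simp]: "x \<otimes>\<^bsub>grigorchuk_group\<^esub> y = x \<circ> y"
  by (simp add: grigorchuk_group_def tree_aut_group_def)

lemma grig_one [simp]: "\<one>\<^bsub>grigorchuk_group\<^esub> = id"
  by (simp add: grigorchuk_group_def tree_aut_group_def)

lemma grig_pow: "x [^]\<^bsub>grigorchuk_group\<^esub> (n::nat) = x ^^ n"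
  by (induction n) (simp_all flip: funpow_Suc_right)

lemma grig_comp_closed [simp]:
  "\<lbrakk>g \<in> carrier grigorchuk_group; h \<in> carrier grigorchuk_group\<rbrakk> \<Longrightarrow> g \<circ> h \<in> carrier grigorchuk_group"
  using grig.m_closed[of g h] by simp

lemma grig_inv_apply [simp]:
  assumes "g \<in> carrier grigorchuk_group"
  shows "(inv\<^bsub>grigorchuk_group\<^esub> g) (g v) = v" "g ((inv\<^bsub>grigorchuk_group\<^esub> g) v) = v"
  using grig.l_inv[OF assms] grig.r_inv[OF assms] by (simp_all add: fun_eq_iff)

lemma grig_Nil: "g \<in> carrier grigorchuk_group \<Longrightarrow> g [] = []"
  by (auto simp: carrier_grigorchuk_group)

lemma grig_sections:
  assumes "g \<in> carrier grigorchuk_group"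
  obtains p s where "\<And>x. s x \<in> carrier grigorchuk_group" "\<And>x v. g (x # v) = (x \<noteq> p) # s x v"
proof -
  obtain w where "g = word_map w" using assms by (auto simp: carrier_grigorchuk_group)
  then show thesis
    by (intro that[of "\<lambda>x. word_map (word_section w x)" "flips w"]) (simp_all add: word_map_Cons_vertex)
qed

lemma iterated_square: "g \<in> carrier grigorchuk_group \<Longrightarrow>
  ((\<lambda>x. x [^]\<^bsub>grigorchuk_group\<^esub> (2::nat)) ^^ N) g = g [^]\<^bsub>grigorchuk_group\<^esub> ((2::nat) ^ N)"
  by (induction N) (simp_all add: grig.nat_pow_pow mult.commute)

lemma grig_two_torsion:
  assumes "g \<in> carrier grigorchuk_group"
  shows "\<exists>N::nat. N \<ge> 1 \<and> g [^]\<^bsub>grigorchuk_group\<^esub> ((2::nat) ^ N) = \<one>\<^bsub>grigorchuk_group\<^esub>"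
proof -
  obtain N :: nat where "g ^^ (2 ^ N) = id"
    using assms two_torsion_word_map by (auto simp: carrier_grigorchuk_group two_torsion_def)
  \<comment> \<open>The exponent found may be \<open>N = 0\<close>; one more squaring ensures
    \<open>N \<ge> 1\<close>.\<close>
  then have "g ^^ (2 ^ Suc N) = id" by (rule funpow_two_power_mono) simp
  then show ?thesis by (intro exI[of _ "Suc N"]) (simp add: grig_pow)
qed

section \<open>Sections of normal subgroups\<close>

text \<open>For \<open>N\<close> inside the group, this is the stabiliser of \<open>v\<close> in
  \<open>N\<close>, restricted to the subtree below \<open>v\<close> and read as acting on the whole
  tree.\<close>

definition sections_at :: "bool list \<Rightarrow> (bool list \<Rightarrow> bool list) set \<Rightarrow> (bool list \<Rightarrow> bool list) set" where
  "sections_at v N = {h. \<exists>g \<in> N. \<forall>w. g (v @ w) = v @ h w}"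

lemma sections_atI: "\<lbrakk>g \<in> N; \<And>w. g (v @ w) = v @ h w\<rbrakk> \<Longrightarrow> h \<in> sections_at v N"
  by (auto simp: sections_at_def)

lemma sections_at_append: "sections_at v (sections_at u N) \<subseteq> sections_at (u @ v) N"
proof
  fix h assume "h \<in> sections_at v (sections_at u N)"
  then obtain k g where "g \<in> N" "\<And>w. g (u @ w) = u @ k w" "\<And>w. k (v @ w) = v @ h w"
    by (auto simp: sections_at_def)
  then show "h \<in> sections_at (u @ v) N" by (intro sections_atI[of g]) auto
qed

text \<open>Self-similarity: descend along \<open>v\<close>, each section at a child being again in
  the group.\<close>

lemma grig_section_closed:
  assumes "g \<in> carrier grigorchuk_group" "\<And>w. g (v @ w) = v @ h w"
  shows "h \<in> carrier grigorchuk_group"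
  using assms
proof (induction v arbitrary: g)
  case Nil
  then have "h = g" by (simp add: fun_eq_iff)
  then show ?case using Nil by simp
next
  case (Cons x v)
  obtain p s where s: "\<And>y. s y \<in> carrier grigorchuk_group" "\<And>y w. g (y # w) = (y \<noteq> p) # s y w"
    using grig_sections[OF Cons.prems(1)] by metis
  have "s x (v @ w) = v @ h w" for w using s(2)[of x "v @ w"] Cons.prems(2)[of w] by simp
  then show ?case using Cons.IH s(1) by blast
qed

text \<open>On the right subtree aba, d, b, c act as a, b, c, d respectively; conjugation by a
  transfers this to the left one.\<close>

lemma section_onto_letter: "\<exists>g \<in> carrier grigorchuk_group. \<forall>v. g (x # v) = x # letter_map l v"
proof -
  have T: "\<exists>g \<in> carrier grigorchuk_group. \<forall>v. g (True # v) = True # letter_map l v"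
  proof (cases l)
    case A
    show ?thesis by (rule bexI[of _ "grig_a \<circ> grig_b \<circ> grig_a"]) (simp_all add: A)
  next
    case B
    show ?thesis by (rule bexI[of _ grig_d]) (simp_all add: B)
  next
    case C
    show ?thesis by (rule bexI[of _ grig_b]) (simp_all add: C)
  next
    case D
    show ?thesis by (rule bexI[of _ grig_c]) (simp_all add: D)
  qed
  then obtain g where g: "g \<in> carrier grigorchuk_group" "\<And>v. g (True # v) = True # letter_map l v"
    by blast
  show ?thesis
  proof (cases x)
    case True
    then show ?thesis using T by simp
  next
    case False
    then show ?thesis using g by (intro bexI[of _ "grig_a \<circ> g \<circ> grig_a"]) simp_all
  qed
qed

lemma section_onto_child:
  assumes "h \<in> carrier grigorchuk_group"
  shows "\<exists>g \<in> carrier grigorchuk_group. \<forall>v. g (x # v) = x # h v"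
proof -
  have "\<exists>g \<in> carrier grigorchuk_group. \<forall>v. g (x # v) = x # word_map w v" for w
  proof (induction w)
    case Nil
    show ?case using grig.one_closed by (intro bexI[of _ id]) auto
  next
    case (Cons l w)
    then obtain f g where "f \<in> carrier grigorchuk_group" "\<forall>v. f (x # v) = x # letter_map l v"
      "g \<in> carrier grigorchuk_group" "\<forall>v. g (x # v) = x # word_map w v"
      using section_onto_letter by metis
    then show ?case by (intro bexI[of _ "f \<circ> g"]) simp_all
  qed
  then show ?thesis using assms by (auto simp: carrier_grigorchuk_group)
qed

text \<open>The group is fractal: the stabiliser of any vertex restricts onto the whole group. It
  suffices to lift \<open>h\<close> one level at a time.\<close>

lemma section_onto:
  assumes "h \<in> carrier grigorchuk_group"
  shows "\<exists>g \<in> carrier grigorchuk_group. \<forall>w. g (v @ w) = v @ h w"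
proof (induction v)
  case Nil
  show ?case using assms by auto
next
  case (Cons x v)
  then obtain g where g: "g \<in> carrier grigorchuk_group" "\<forall>w. g (v @ w) = v @ h w" by blast
  obtain f where "f \<in> carrier grigorchuk_group" "\<forall>v. f (x # v) = x # g v"
    using section_onto_child[OF g(1)] by blast
  then show ?case using g by (intro bexI[of _ f]) simp_all
qed

lemma normal_grigI:
  assumes "subgroup N grigorchuk_group"
    and "\<And>f h. \<lbrakk>f \<in> carrier grigorchuk_group; h \<in> N\<rbrakk> \<Longrightarrow> f \<circ> h \<circ> inv\<^bsub>grigorchuk_group\<^esub> f \<in> N"
  shows "N \<lhd> grigorchuk_group"
  using assms by (intro grig.normal_invI) auto

text \<open>To conjugate a section by \<open>f\<close>, lift \<open>f\<close> to some
  \<open>k\<close> that fixes \<open>v\<close> and has section \<open>f\<close> there; then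
  conjugate by \<open>k\<close> inside \<open>N\<close>.\<close>

lemma normal_sections_at:
  assumes "N \<lhd> grigorchuk_group"
  shows "sections_at v N \<lhd> grigorchuk_group"
proof (rule normal_grigI)
  interpret N: normal N grigorchuk_group by fact
  have sub: "h \<in> carrier grigorchuk_group" if h: "h \<in> sections_at v N" for h
  proof -
    obtain g where "g \<in> N" "\<And>w. g (v @ w) = v @ h w" using h by (auto simp: sections_at_def)
    then show ?thesis using grig_section_closed[of g v h] by simp
  qed
  have inv: "(inv\<^bsub>grigorchuk_group\<^esub> g) (v @ w) = v @ (inv\<^bsub>grigorchuk_group\<^esub> h) w"
    if g: "g \<in> carrier grigorchuk_group" "\<forall>w. g (v @ w) = v @ h w" for g h w
  proof -
    have "h \<in> carrier grigorchuk_group" using that grig_section_closed by blast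
    then have "v @ w = g (v @ (inv\<^bsub>grigorchuk_group\<^esub> h) w)" using g by simp
    then show ?thesis using g(1) by simp
  qed
  show "subgroup (sections_at v N) grigorchuk_group"
  proof (rule grig.subgroupI)
    have "id \<in> N" using N.one_closed by simp
    then have "id \<in> sections_at v N" by (rule sections_atI) simp
    then show "sections_at v N \<noteq> {}" by blast
  next
    fix h assume "h \<in> sections_at v N"
    then obtain g where g: "g \<in> N" "\<forall>w. g (v @ w) = v @ h w" by (auto simp: sections_at_def)
    show "inv\<^bsub>grigorchuk_group\<^esub> h \<in> sections_at v N"
      using g by (intro sections_atI[of "inv\<^bsub>grigorchuk_group\<^esub> g"] inv) auto
  next
    fix h h' assume "h \<in> sections_at v N" "h' \<in> sections_at v N"
    then obtain g g' where "g \<in> N" "\<forall>w. g (v @ w) = v @ h w" "g' \<in> N" "\<forall>w. g' (v @ w) = v @ h' w"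
      by (auto simp: sections_at_def)
    moreover from this have "g \<circ> g' \<in> N" using N.m_closed[of g g'] by simp
    ultimately show "h \<otimes>\<^bsub>grigorchuk_group\<^esub> h' \<in> sections_at v N"
      by (intro sections_atI[of "g \<circ> g'"]) auto
  qed (use sub in blast)
  fix f h assume f: "f \<in> carrier grigorchuk_group" and "h \<in> sections_at v N"
  then obtain g where g: "g \<in> N" "\<forall>w. g (v @ w) = v @ h w" by (auto simp: sections_at_def)
  obtain k where k: "k \<in> carrier grigorchuk_group" "\<forall>w. k (v @ w) = v @ f w"
    using section_onto[OF f] by blast
  have "k \<circ> g \<circ> inv\<^bsub>grigorchuk_group\<^esub> k \<in> N" using N.inv_op_closed2[OF k(1) g(1)] by simp
  then show "f \<circ> h \<circ> inv\<^bsub>grigorchuk_group\<^esub> f \<in> sections_at v N"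
    using g k inv[OF k] by (intro sections_atI[of "k \<circ> g \<circ> inv\<^bsub>grigorchuk_group\<^esub> k"]) auto
qed

section \<open>Normal subgroups that have the whole group as sections\<close>

lemma normal_grig_comp:
  assumes "N \<lhd> grigorchuk_group" "g \<in> N" "h \<in> N"
  shows "g \<circ> h \<in> N"
  using subgroup.m_closed[OF normal_imp_subgroup[OF assms(1)] assms(2,3)] by simp

lemma normal_grig_conj:
  assumes "N \<lhd> grigorchuk_group" "g \<in> N" "f \<in> carrier grigorchuk_group" "f \<circ> f = id"
  shows "f \<circ> g \<circ> f \<in> N"
proof -
  have "inv\<^bsub>grigorchuk_group\<^esub> f = f" by (rule grig.inv_equality) (use assms in auto)
  then show ?thesis using normal.inv_op_closed2[OF assms(1,3,2)] by simp
qed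

lemma grig_generators_involution:
  "grig_a \<circ> grig_a = id" "grig_b \<circ> grig_b = id" "grig_c \<circ> grig_c = id" "grig_d \<circ> grig_d = id"
  by (simp_all add: fun_eq_iff grig_a_involution grig_bcd_involution)

definition replicating :: "(bool list \<Rightarrow> bool list) set \<Rightarrow> bool" where
  "replicating N \<longleftrightarrow> (\<exists>v. sections_at v N = carrier grigorchuk_group)"

text \<open>This permits replacing \<open>N\<close> by its sections, again normal, as often as
  convenient; the vertices are concatenated.\<close>

lemma replicating_sections_at:
  assumes "N \<lhd> grigorchuk_group" "replicating (sections_at u N)"
  shows "replicating N"
proof -
  obtain v where "sections_at v (sections_at u N) = carrier grigorchuk_group"
    using assms(2) by (auto simp: replicating_def)
  then have "carrier grigorchuk_group \<subseteq> sections_at (u @ v) N" using sections_at_append by blast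
  moreover have "sections_at (u @ v) N \<subseteq> carrier grigorchuk_group"
    using subgroup.subset[OF normal_imp_subgroup[OF normal_sections_at[OF assms(1)]]] .
  ultimately show ?thesis unfolding replicating_def by blast
qed

text \<open>On the left subtree b acts as a, aba as c, and acad as d. Since b = cd, all generators
  are sections of \<open>N\<close> there.\<close>

lemma replicating_if_b_ac_ad:
  assumes N: "N \<lhd> grigorchuk_group"
    and b: "grig_b \<in> N" and ac: "grig_a \<circ> grig_c \<in> N" and ad: "grig_a \<circ> grig_d \<in> N"
  shows "replicating N"
proof -
  let ?M = "sections_at [False] N"
  have M: "?M \<lhd> grigorchuk_group" by (rule normal_sections_at[OF N])
  have a': "grig_a \<in> ?M" using b by (intro sections_atI) auto
  have "grig_a \<circ> grig_b \<circ> grig_a \<in> N"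
    using normal_grig_conj[OF N b] by (simp add: grig_generators_involution)
  then have c': "grig_c \<in> ?M" by (rule sections_atI) simp
  have "(grig_a \<circ> grig_c) \<circ> (grig_a \<circ> grig_d) \<in> N" using N ac ad by (rule normal_grig_comp)
  then have d': "grig_d \<in> ?M" by (rule sections_atI) simp
  have "grig_c \<circ> grig_d \<in> ?M" using M c' d' by (rule normal_grig_comp)
  then have b': "grig_b \<in> ?M" by (simp add: comp_def grig_bcd_product)
  have letter: "letter_map l \<in> ?M" for l using a' b' c' d' by (cases l) auto
  have "id \<in> ?M" using subgroup.one_closed[OF normal_imp_subgroup[OF M]] by simp
  then have "word_map w \<in> ?M" for w
    by (induction w) (auto intro: normal_grig_comp[OF M] letter)
  then have "?M = carrier grigorchuk_group"
    using subgroup.subset[OF normal_imp_subgroup[OF M]] by (auto simp: carrier_grigorchuk_group)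
  then show ?thesis by (auto simp: replicating_def)
qed

text \<open>For x = (y, z) among b, c, d the commutator a(xax) lies in \<open>N\<close> and acts on
  the right subtree as yz. Taking x = d, b, c gives b, ac, ad.\<close>

lemma replicating_if_a:
  assumes N: "N \<lhd> grigorchuk_group" and a: "grig_a \<in> N"
  shows "replicating N"
proof -
  let ?M = "sections_at [True] N"
  have comm: "grig_a \<circ> (x \<circ> grig_a \<circ> x) \<in> N" if "x \<in> carrier grigorchuk_group" "x \<circ> x = id" for x
    using normal_grig_comp[OF N a] normal_grig_conj[OF N a that] by blast
  have "grig_b \<in> ?M"
    by (rule sections_atI[OF comm[of grig_d]]) (simp_all add: grig_generators_involution)
  moreover have "grig_a \<circ> grig_c \<in> ?M"
    by (rule sections_atI[OF comm[of grig_b]]) (simp_all add: grig_generators_involution)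
  moreover have "grig_a \<circ> grig_d \<in> ?M"
    by (rule sections_atI[OF comm[of grig_c]]) (simp_all add: grig_generators_involution)
  ultimately have "replicating ?M" using replicating_if_b_ac_ad normal_sections_at[OF N] by blast
  then show ?thesis by (rule replicating_sections_at[OF N])
qed

lemma replicating_if_b:
  assumes N: "N \<lhd> grigorchuk_group" and b: "grig_b \<in> N"
  shows "replicating N"
proof -
  have "grig_a \<in> sections_at [False] N" using b by (intro sections_atI) auto
  then show ?thesis
    using replicating_if_a normal_sections_at[OF N] replicating_sections_at[OF N] by blast
qed

text \<open>The commutator of \<open>g\<close> with d = (1, b) has section b at the right child:
  after b is applied there, the inverse of \<open>g\<close> moves to the left subtree, where d is
  trivial, and \<open>g\<close> moves back.\<close>

lemma replicating_if_swap:
  assumes N: "N \<lhd> grigorchuk_group" and g: "g \<in> N" and swap: "\<And>x v. \<exists>v'. g (x # v) = (\<not> x) # v'"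
  shows "replicating N"
proof -
  interpret N: normal N grigorchuk_group by fact
  let ?g' = "inv\<^bsub>grigorchuk_group\<^esub> g"
  have gG: "g \<in> carrier grigorchuk_group" using g by simp
  have "?g' \<in> N" using g by simp
  have "g \<circ> (grig_d \<circ> ?g' \<circ> grig_d) \<in> N"
    by (intro normal_grig_comp[OF N g] normal_grig_conj[OF N \<open>?g' \<in> N\<close>])
      (simp_all add: grig_generators_involution)
  moreover have "(g \<circ> (grig_d \<circ> ?g' \<circ> grig_d)) ([True] @ v) = [True] @ grig_b v" for v
  proof -
    obtain x u where xu: "?g' (True # grig_b v) = x # u"
    proof (cases "?g' (True # grig_b v)")
      case Nil
      then have "g [] = True # grig_b v" using grig_inv_apply(2)[OF gG, of "True # grig_b v"] by simp
      then show thesis using grig_Nil[OF gG] by simp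
    qed (use that in blast)
    then have "g (x # u) = True # grig_b v" using grig_inv_apply(2)[OF gG, of "True # grig_b v"] by simp
    then have "x = False" using swap[of x u] by auto
    then show ?thesis using xu grig_inv_apply(2)[OF gG, of "True # grig_b v"] by simp
  qed
  ultimately have "grig_b \<in> sections_at [True] N" by (rule sections_atI)
  then show ?thesis
    using replicating_if_b normal_sections_at[OF N] replicating_sections_at[OF N] by blast
qed

text \<open>Follow the moved vertex downwards: as long as the children are not swapped, the rest of
  the vertex is moved by the section at its first letter. The root cannot be moved, so a swap must
  occur.\<close>

lemma grig_swap_section:
  assumes "g \<in> carrier grigorchuk_group" "g u \<noteq> u"
  shows "\<exists>v h. (\<forall>w. g (v @ w) = v @ h w) \<and> (\<forall>x w. \<exists>w'. h (x # w) = (\<not> x) # w')"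
  using assms
proof (induction u arbitrary: g)
  case Nil
  then show ?case using grig_Nil by blast
next
  case (Cons x u)
  obtain p s where s: "\<And>y. s y \<in> carrier grigorchuk_group" "\<And>y w. g (y # w) = (y \<noteq> p) # s y w"
    using grig_sections[OF Cons.prems(1)] by metis
  show ?case
  proof (cases p)
    case True
    then show ?thesis by (intro exI[of _ "[]"] exI[of _ g]) (simp add: s(2))
  next
    case False
    then have "s x u \<noteq> u" using Cons.prems(2) s(2)[of x u] by simp
    then obtain v h where "\<forall>w. s x (v @ w) = v @ h w" "\<forall>x w. \<exists>w'. h (x # w) = (\<not> x) # w'"
      using Cons.IH[OF s(1)] by blast
    then show ?thesis using False by (intro exI[of _ "x # v"] exI[of _ h]) (simp add: s(2))
  qed
qed

lemma normal_replicating: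
  assumes N: "N \<lhd> grigorchuk_group" and "N \<noteq> {id}"
  shows "replicating N"
proof -
  have sub: "subgroup N grigorchuk_group" by (rule normal_imp_subgroup[OF N])
  obtain g where g: "g \<in> N" "g \<noteq> id"
    using assms(2) subgroup.one_closed[OF sub] by auto
  then obtain u where u: "g u \<noteq> u" by (auto simp: fun_eq_iff)
  obtain v h where h: "\<forall>w. g (v @ w) = v @ h w" "\<forall>x w. \<exists>w'. h (x # w) = (\<not> x) # w'"
    using grig_swap_section[OF subgroup.mem_carrier[OF sub g(1)] u] by metis
  have "h \<in> sections_at v N" using g h by (intro sections_atI[of g]) auto
  then have "replicating (sections_at v N)"
    using replicating_if_swap[OF normal_sections_at[OF N]] h(2) by blast
  then show ?thesis by (rule replicating_sections_at[OF N])
qed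

lemma normal_involves_grigorchuk_group:
  assumes N: "N \<lhd> grigorchuk_group" and "N \<noteq> {\<one>\<^bsub>grigorchuk_group\<^esub>}"
  shows "involves (grigorchuk_group\<lparr>carrier := N\<rparr>) grigorchuk_group"
proof -
  interpret N: normal N grigorchuk_group by fact
  obtain v where v: "sections_at v N = carrier grigorchuk_group"
    using normal_replicating[OF N] assms(2) by (auto simp: replicating_def)
  \<comment> \<open>\<open>K\<close> is the stabiliser of \<open>v\<close> in \<open>N\<close>, and
    \<open>\<phi>\<close> reads off the section at \<open>v\<close> by dropping the prefix.\<close>
  define K where "K = {g \<in> N. \<exists>h. \<forall>w. g (v @ w) = v @ h w}"
  define \<phi> where "\<phi> g = (\<lambda>w. drop (length v) (g (v @ w)))" for g :: "bool list \<Rightarrow> bool list"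
  have \<phi>: "g (v @ w) = v @ \<phi> g w" if "g \<in> K" for g w
    using that by (auto simp: K_def \<phi>_def)
  have \<phi>_eq: "\<phi> g = h" if "\<And>w. g (v @ w) = v @ h w" for g h
    using that by (simp add: \<phi>_def)
  have \<phi>_closed: "\<phi> g \<in> carrier grigorchuk_group" if "g \<in> K" for g
    using grig_section_closed[of g v "\<phi> g"] \<phi>[OF that] that by (auto simp: K_def)
  have K_comp: "g \<circ> h \<in> K" if "g \<in> K" "h \<in> K" for g h
    using that normal_grig_comp[OF N, of g h] \<phi> by (auto simp: K_def)
  have K: "subgroup K grigorchuk_group"
  proof (rule grig.subgroupI)
    show "K \<noteq> {}" using N.one_closed by (auto simp: K_def intro!: exI[of _ id])
  next
    fix g assume g: "g \<in> K"
    let ?h' = "inv\<^bsub>grigorchuk_group\<^esub> (\<phi> g)"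
    have gG: "g \<in> carrier grigorchuk_group" "g \<in> N" using g by (auto simp: K_def)
    have "(inv\<^bsub>grigorchuk_group\<^esub> g) (v @ w) = v @ ?h' w" for w
    proof -
      have "v @ w = g (v @ ?h' w)" using \<phi>[OF g, of "?h' w"] \<phi>_closed[OF g] by simp
      then show ?thesis using gG by simp
    qed
    then show "inv\<^bsub>grigorchuk_group\<^esub> g \<in> K" using gG by (auto simp: K_def)
  next
    fix g h assume "g \<in> K" "h \<in> K"
    then show "g \<otimes>\<^bsub>grigorchuk_group\<^esub> h \<in> K" using K_comp by simp
  qed (auto simp: K_def)
  have "subgroup K (grigorchuk_group\<lparr>carrier := N\<rparr>)"
    using K by (intro grig.subgroup_incl N.is_subgroup) (auto simp: K_def)
  moreover have "\<phi> \<in> hom (grigorchuk_group\<lparr>carrier := K\<rparr>) grigorchuk_group"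
    by (rule homI) (auto simp: \<phi>_closed \<phi> intro!: \<phi>_eq)
  moreover have "\<phi> ` K = carrier grigorchuk_group"
  proof
    show "carrier grigorchuk_group \<subseteq> \<phi> ` K"
    proof
      fix h assume "h \<in> carrier grigorchuk_group"
      then obtain g where g: "g \<in> N" "\<And>w. g (v @ w) = v @ h w"
        using v by (auto simp: sections_at_def)
      then have "g \<in> K" by (auto simp: K_def)
      then show "h \<in> \<phi> ` K" using \<phi>_eq[of g h] g(2) by blast
    qed
  qed (auto simp: \<phi>_closed)
  ultimately show ?thesis by (intro involvesI) simp_all
qed

section \<open>Unbounded exponent\<close>

text \<open>The rigid stabiliser of the left child, viewed through its action on that subtree: all
  \<open>k\<close> for which (k, 1) is in the group.\<close>

definition left_rigid :: "(bool list \<Rightarrow> bool list) set" where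
  "left_rigid = {k \<in> carrier grigorchuk_group. \<exists>g \<in> carrier grigorchuk_group.
     \<forall>v. g (False # v) = False # k v \<and> g (True # v) = True # v}"

text \<open>Conjugate (k, 1) by an element \<open>l\<close> that fixes the left child and has
  section \<open>f\<close> there.\<close>

lemma normal_left_rigid: "left_rigid \<lhd> grigorchuk_group"
proof (rule normal_grigI)
  show "subgroup left_rigid grigorchuk_group"
  proof (rule grig.subgroupI)
    show "left_rigid \<noteq> {}" using grig.one_closed by (auto simp: left_rigid_def intro!: exI[of _ id] bexI[of _ id])
  next
    fix k assume "k \<in> left_rigid"
    then obtain g where k: "k \<in> carrier grigorchuk_group" and g: "g \<in> carrier grigorchuk_group"
      "\<And>v. g (False # v) = False # k v" "\<And>v. g (True # v) = True # v"
      by (auto simp: left_rigid_def)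
    have "(inv\<^bsub>grigorchuk_group\<^esub> g) (False # v) = False # (inv\<^bsub>grigorchuk_group\<^esub> k) v" for v
      using g(2)[of "(inv\<^bsub>grigorchuk_group\<^esub> k) v"] k
        grig_inv_apply(1)[OF g(1), of "False # (inv\<^bsub>grigorchuk_group\<^esub> k) v"] by simp
    moreover have "(inv\<^bsub>grigorchuk_group\<^esub> g) (True # v) = True # v" for v
      using g(3)[of v] grig_inv_apply(1)[OF g(1), of "True # v"] by simp
    ultimately show "inv\<^bsub>grigorchuk_group\<^esub> k \<in> left_rigid"
      using k g(1) by (auto simp: left_rigid_def intro!: bexI[of _ "inv\<^bsub>grigorchuk_group\<^esub> g"])
  next
    fix k k' assume "k \<in> left_rigid" "k' \<in> left_rigid"
    then obtain g g' where "k \<in> carrier grigorchuk_group" "k' \<in> carrier grigorchuk_group"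
      "g \<in> carrier grigorchuk_group" "g' \<in> carrier grigorchuk_group"
      "\<forall>v. g (False # v) = False # k v \<and> g (True # v) = True # v"
      "\<forall>v. g' (False # v) = False # k' v \<and> g' (True # v) = True # v"
      by (auto simp: left_rigid_def)
    then show "k \<otimes>\<^bsub>grigorchuk_group\<^esub> k' \<in> left_rigid"
      by (auto simp: left_rigid_def intro!: bexI[of _ "g \<circ> g'"])
  qed (auto simp: left_rigid_def)
next
  fix f k assume f: "f \<in> carrier grigorchuk_group" and "k \<in> left_rigid"
  then obtain g where k: "k \<in> carrier grigorchuk_group" and g: "g \<in> carrier grigorchuk_group"
    "\<And>v. g (False # v) = False # k v" "\<And>v. g (True # v) = True # v"
    by (auto simp: left_rigid_def)
  obtain l where l: "l \<in> carrier grigorchuk_group" "\<And>v. l (False # v) = False # f v"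
    using section_onto_child[OF f] by blast
  let ?l' = "inv\<^bsub>grigorchuk_group\<^esub> l" and ?f' = "inv\<^bsub>grigorchuk_group\<^esub> f"
  have l'_False: "?l' (False # v) = False # ?f' v" for v
    using l(2)[of "?f' v"] f grig_inv_apply(1)[OF l(1), of "False # ?f' v"] by simp
  obtain p s where s: "\<And>x v. ?l' (x # v) = (x \<noteq> p) # s x v"
    using grig_sections[of ?l'] l(1) by (metis grig.inv_closed)
  \<comment> \<open>The inverse of \<open>l\<close> fixes the left child, so it does not swap the
    children and fixes the right one too.\<close>
  have "?l' (True # v) = True # s True v" for v using s[of True v] s[of False v] l'_False[of v] by simp
  then have "l (g (?l' (True # v))) = True # v" for v
    using g(3) grig_inv_apply(2)[OF l(1), of "True # v"] by simp
  moreover have "l (g (?l' (False # v))) = False # (f \<circ> k \<circ> ?f') v" for v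
    by (simp add: l'_False g(2) l(2))
  ultimately show "f \<circ> k \<circ> ?f' \<in> left_rigid"
    using f k l(1) g(1) by (auto simp: left_rigid_def intro!: bexI[of _ "l \<circ> g \<circ> ?l'"])
qed

lemma left_rigid_nontrivial: "left_rigid \<noteq> {id}"
proof -
  let ?k = "grig_a \<circ> grig_b \<circ> grig_a \<circ> grig_b"
  have "?k \<in> left_rigid"
    unfolding left_rigid_def
    \<comment> \<open>Here ada = (b, 1) and b = (a, c), so their commutator is (abab, cc) = (abab,
      1).\<close>
    by (intro CollectI conjI bexI[of _ "grig_b \<circ> (grig_a \<circ> grig_d \<circ> grig_a) \<circ> grig_b \<circ> (grig_a \<circ> grig_d \<circ> grig_a)"])
      (auto simp: grig_bcd_involution)
  moreover have "?k [False, False] \<noteq> id [False, False]" by simp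
  ultimately show ?thesis by (metis singletonD)
qed

text \<open>If \<open>k\<close> acts below the left child only, composing with the swap of the two children
  yields a square root of \<open>(k, k)\<close>, so the exponent of the group would be twice that of
  \<open>left_rigid\<close>; but the latter has all of the group among its sections.\<close>

lemma grig_halve_exponent:
  assumes exp: "\<And>g. g \<in> carrier grigorchuk_group \<Longrightarrow> g ^^ (2 ^ Suc N) = id"
    and h: "h \<in> carrier grigorchuk_group"
  shows "h ^^ (2 ^ N) = id"
proof -
  obtain v where "sections_at v left_rigid = carrier grigorchuk_group"
    using normal_replicating[OF normal_left_rigid left_rigid_nontrivial] by (auto simp: replicating_def)
  then obtain k where k: "k \<in> left_rigid" "\<And>w. k (v @ w) = v @ h w"
    using h by (auto simp: sections_at_def)
  then obtain g where g: "g \<in> carrier grigorchuk_group"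
    "\<And>v. g (False # v) = False # k v" "\<And>v. g (True # v) = True # v"
    by (auto simp: left_rigid_def)
  define t where "t = g \<circ> grig_a"
  have tt: "((t \<circ> t) ^^ n) (True # u) = True # (k ^^ n) u" for n u
    by (induction n) (simp_all add: t_def g)
  have kn: "(k ^^ n) (v @ w) = v @ (h ^^ n) w" for n w
    by (induction n) (simp_all add: k(2))
  have "(t \<circ> t) ^^ (2 ^ N) = t ^^ (2 ^ Suc N)"
    using funpow_mult[where m = 2 and f = t and n = "2 ^ N"] by (simp add: numeral_2_eq_2 mult.commute)
  also have "\<dots> = id" by (rule exp) (simp add: t_def g(1))
  finally have "True # v @ (h ^^ (2 ^ N)) w = True # v @ w" for w
    using tt[of "2 ^ N" "v @ w"] by (simp add: kn)
  then show ?thesis by (simp add: fun_eq_iff)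
qed

text \<open>If 2^(N+1) were an exponent of the group, so would be 2^N, and in the end 2^0 = 1; but a
  is not the identity.\<close>

lemma grig_unbounded_exponent: "\<exists>g \<in> carrier grigorchuk_group. g ^^ (2 ^ N) \<noteq> id"
proof (induction N)
  case 0
  have "(grig_a ^^ (2 ^ 0)) [True] \<noteq> id [True]" by simp
  then show ?case by (metis grig_generators_in_grigorchuk_group(1))
next
  case (Suc N)
  then show ?case using grig_halve_exponent by blast
qed

text \<open>A finite exponent passes to subgroups and to homomorphic images.\<close>

lemma bounded_2_torsion_not_involves:
  assumes "bounded_2_torsion H"
  shows "\<not> involves H grigorchuk_group"
proof
  assume "involves H grigorchuk_group"
  then obtain K \<phi> where K: "subgroup K H" "\<phi> \<in> hom (H\<lparr>carrier := K\<rparr>) grigorchuk_group"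
    "\<phi> ` K = carrier grigorchuk_group"
    by (rule involvesE)
  obtain N :: nat where N: "\<forall>h \<in> carrier H. h [^]\<^bsub>H\<^esub> ((2::nat) ^ N) = \<one>\<^bsub>H\<^esub>"
    using assms by (auto simp: bounded_2_torsion_def)
  interpret H: group H using assms unfolding bounded_2_torsion_def by blast
  interpret \<phi>: group_hom "H\<lparr>carrier := K\<rparr>" grigorchuk_group \<phi>
    by (intro group_hom.intro group_hom_axioms.intro H.subgroup_imp_group K(1,2) group_grigorchuk_group)
  have "g ^^ (2 ^ N) = id" if "g \<in> carrier grigorchuk_group" for g
  proof -
    have "g \<in> \<phi> ` K" using that K(3) by simp
    then obtain x where x: "x \<in> K" "g = \<phi> x" by blast
    have "x \<in> carrier H" using x(1) subgroup.mem_carrier[OF K(1)] by blast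
    then have pow: "x [^]\<^bsub>H\<^esub> ((2::nat) ^ N) = \<one>\<^bsub>H\<^esub>" using N by blast
    have "g ^^ (2 ^ N) = \<phi> (x [^]\<^bsub>H\<lparr>carrier := K\<rparr>\<^esub> ((2::nat) ^ N))"
      using \<phi>.hom_nat_pow[of x "2 ^ N"] x by (simp add: grig_pow)
    also have "\<dots> = \<phi> \<one>\<^bsub>H\<lparr>carrier := K\<rparr>\<^esub>"
      using pow by (simp flip: H.nat_pow_consistent)
    also have "\<dots> = id" using \<phi>.hom_one unfolding grig_one .
    finally show ?thesis .
  qed
  then show False using grig_unbounded_exponent by blast
qed

text \<open>The group was defined by generation inside \<open>tree_aut_group\<close>; the closure
  theorem asks for generation inside the group itself.\<close>

lemma generate_grigorchuk_group:
  "generate grigorchuk_group {grig_a, grig_b, grig_c, grig_d} = carrier grigorchuk_group"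
proof
  have "word_map w \<in> generate grigorchuk_group {grig_a, grig_b, grig_c, grig_d}" for w
  proof (induction w)
    case Nil
    show ?case using generate.one[of grigorchuk_group] unfolding word_map.simps grig_one .
  next
    case (Cons l w)
    have "letter_map l \<in> generate grigorchuk_group {grig_a, grig_b, grig_c, grig_d}"
      by (rule generate.incl) (cases l; simp)
    from generate.eng[OF this Cons] show ?case unfolding grig_mult word_map.simps .
  qed
  then show "carrier grigorchuk_group \<subseteq> generate grigorchuk_group {grig_a, grig_b, grig_c, grig_d}"
    by (auto simp: carrier_grigorchuk_group)
qed (rule grig.generate_incl, simp)

theorem mainTheorem9:
  shows "iterated_identity grigorchuk_group (\<lambda>x. x [^]\<^bsub>grigorchuk_group\<^esub> (2::nat))
       \<and> (\<forall>g \<in> carrier grigorchuk_group. \<exists>N::nat. N \<ge> 1 \<and>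
            g [^]\<^bsub>grigorchuk_group\<^esub> ((2::nat) ^ N) = \<one>\<^bsub>grigorchuk_group\<^esub>)
       \<and> \<not> (\<exists>G :: 'u monoid. elementary_closure bounded_2_torsion G \<and> G \<cong> grigorchuk_group)"
proof (intro conjI notI)
  show "iterated_identity grigorchuk_group (\<lambda>x. x [^]\<^bsub>grigorchuk_group\<^esub> (2::nat))"
    unfolding iterated_identity_def using grig_two_torsion iterated_square by metis
  show "\<forall>g \<in> carrier grigorchuk_group. \<exists>N::nat. N \<ge> 1 \<and>
      g [^]\<^bsub>grigorchuk_group\<^esub> ((2::nat) ^ N) = \<one>\<^bsub>grigorchuk_group\<^esub>"
    using grig_two_torsion by blast
  assume "\<exists>G :: 'u monoid. elementary_closure bounded_2_torsion G \<and> G \<cong> grigorchuk_group"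
  then obtain G :: "'u monoid" where G: "elementary_closure bounded_2_torsion G" "G \<cong> grigorchuk_group"
    by blast
  have "group G \<and> \<not> involves G grigorchuk_group"
  proof (rule elementary_closure_not_involves[OF group_grigorchuk_group _ _ generate_grigorchuk_group])
    show "elementary_closure bounded_2_torsion G" by fact
  qed (auto simp: normal_involves_grigorchuk_group bounded_2_torsion_not_involves bounded_2_torsion_def)
  \<comment> \<open>The group involves itself through the identity, and so does its copy
    \<open>G\<close>, contrary to the previous fact.\<close>
  moreover have "involves grigorchuk_group grigorchuk_group"
    by (rule involvesI[OF grig.subgroup_self, of id]) (auto simp: hom_def)
  ultimately show False
    using involves_iso[OF _ group_grigorchuk_group G(2), of grigorchuk_group] by blast
qed

end
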